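(* Let $R=\mathbb C[x_1,\ldots,x_m]$, let $D_1,\ldots,D_k\in R$, and let $I=\langle D_1,\ldots,D_k\rangle$ have an irredundant primary decomposition $I=I_1\cap\cdots\cap I_n$ (primary ideals with pairwise distinct radicals, none redundant). Put $J_i=I_1\cap\cdots\cap I_i$. Suppose that (1) $\dim\mathcal Z(I_i)=m-k$ for each $i=1,\ldots,n$, and (2) $J_i+I_{i+1}$ is a radical ideal for each $i=1,\ldots,n-1$. Then for every choice of polynomial-valued $(m-k-1)$-forms $\alpha_1,\ldots,\alpha_n$ there exists a polynomial-valued $(m-1)$-form $\omega$ such that $$[\omega]_i=[\alpha_i\wedge dD_1\wedge\cdots\wedge dD_k]_i\qquad\text{for all } i=1,\ldots,n,$$ i.e. every coefficient of $\omega-\alpha_i\wedge dD_1\wedge\cdots\wedge dD_k$ lies in $I_i$, for each $i$.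
   Context: $\mathcal Z(I_i)\subset\mathbb C^m$ is the zero locus of $I_i$ (a branch of the cut solution $\mathcal Z(I)$). A polynomial-valued differential form on $\mathbb C^m$ has polynomial coefficients in the standard basis $dx_{j_1}\wedge\cdots\wedge dx_{j_r}$. For an ideal $I_i$ and forms $\beta,\gamma$ of the same rank, $[\beta]_i=[\gamma]_i$ means that every coefficient of $\beta-\gamma$ in the standard basis lies in $I_i$. An ideal $J$ is radical if $J=\sqrt J$. *)

theory Defs
  imports Complex_Main "HOL-Library.Poly_Mapping"
begin

text \<open>Multivariate polynomials over the complex numbers: finitely supported maps from
  monomials (finitely supported exponent vectors) to coefficients.  The ring
  R = C[x_1,...,x_m] is the subring of polynomials whose monomials only involve the
  variables with index < m (variable x_(j+1) is represented by index j).\<close>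

type_synonym mpoly = "(nat \<Rightarrow>\<^sub>0 nat) \<Rightarrow>\<^sub>0 complex"

definition Rm :: "nat \<Rightarrow> mpoly set" where
  "Rm m = {p. \<forall>\<mu>\<in>Poly_Mapping.keys p. Poly_Mapping.keys \<mu> \<subseteq> {..<m}}"

definition mvar :: "nat \<Rightarrow> mpoly" where
  "mvar j = Poly_Mapping.single (Poly_Mapping.single j 1) 1"

definition meval :: "mpoly \<Rightarrow> (nat \<Rightarrow> complex) \<Rightarrow> complex" where
  "meval p x = (\<Sum>\<mu>\<in>Poly_Mapping.keys p. Poly_Mapping.lookup p \<mu> * (\<Prod>j\<in>Poly_Mapping.keys \<mu>. x j ^ Poly_Mapping.lookup \<mu> j))"

definition mpderiv :: "nat \<Rightarrow> mpoly \<Rightarrow> mpoly" where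
  "mpderiv j p = (\<Sum>\<mu>\<in>Poly_Mapping.keys p.
      Poly_Mapping.single (\<mu> - Poly_Mapping.single j 1) (of_nat (Poly_Mapping.lookup \<mu> j) * Poly_Mapping.lookup p \<mu>))"

definition is_ideal :: "nat \<Rightarrow> mpoly set \<Rightarrow> bool" where
  "is_ideal m J \<longleftrightarrow> J \<subseteq> Rm m \<and> 0 \<in> J \<and> (\<forall>a\<in>J. \<forall>b\<in>J. a + b \<in> J)
     \<and> (\<forall>r\<in>Rm m. \<forall>a\<in>J. r * a \<in> J)"

definition ideal_gen :: "nat \<Rightarrow> mpoly set \<Rightarrow> mpoly set" where
  "ideal_gen m S = \<Inter>{J. is_ideal m J \<and> S \<subseteq> J}"

definition ideal_radical :: "nat \<Rightarrow> mpoly set \<Rightarrow> mpoly set" where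
  "ideal_radical m J = {f \<in> Rm m. \<exists>k::nat. f ^ k \<in> J}"

definition is_radical :: "nat \<Rightarrow> mpoly set \<Rightarrow> bool" where
  "is_radical m J \<longleftrightarrow> J = ideal_radical m J"

definition is_primary :: "nat \<Rightarrow> mpoly set \<Rightarrow> bool" where
  "is_primary m Q \<longleftrightarrow> is_ideal m Q \<and> Q \<noteq> Rm m \<and>
     (\<forall>a\<in>Rm m. \<forall>b\<in>Rm m. a * b \<in> Q \<longrightarrow> a \<in> Q \<or> (\<exists>k::nat. b ^ k \<in> Q))"

definition ideal_sum :: "mpoly set \<Rightarrow> mpoly set \<Rightarrow> mpoly set" where
  "ideal_sum A B = {a + b | a b. a \<in> A \<and> b \<in> B}"

text \<open>Intersection of the ideals Is i for i in a finite index set, taken inside R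
  (so that the empty intersection is the whole ring R).\<close>
definition ideal_Inter :: "nat \<Rightarrow> nat set \<Rightarrow> (nat \<Rightarrow> mpoly set) \<Rightarrow> mpoly set" where
  "ideal_Inter m A Is = Rm m \<inter> (\<Inter>i\<in>A. Is i)"

definition irredundant_primary_decomposition ::
    "nat \<Rightarrow> mpoly set \<Rightarrow> nat \<Rightarrow> (nat \<Rightarrow> mpoly set) \<Rightarrow> bool" where
  "irredundant_primary_decomposition m I n Is \<longleftrightarrow>
     I = ideal_Inter m {1..n} Is \<and>
     (\<forall>i\<in>{1..n}. is_primary m (Is i)) \<and>
     (\<forall>i\<in>{1..n}. \<forall>j\<in>{1..n}. i \<noteq> j \<longrightarrow> ideal_radical m (Is i) \<noteq> ideal_radical m (Is j)) \<and>
     (\<forall>i\<in>{1..n}. \<not> ideal_Inter m ({1..n} - {i}) Is \<subseteq> Is i)"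

definition cspace :: "nat \<Rightarrow> (nat \<Rightarrow> complex) set" where
  "cspace m = {x. \<forall>j\<ge>m. x j = 0}"

definition zero_locus :: "nat \<Rightarrow> mpoly set \<Rightarrow> (nat \<Rightarrow> complex) set" where
  "zero_locus m S = {x \<in> cspace m. \<forall>f\<in>S. meval f x = 0}"

definition zariski_closed :: "nat \<Rightarrow> (nat \<Rightarrow> complex) set \<Rightarrow> bool" where
  "zariski_closed m Y \<longleftrightarrow> (\<exists>S \<subseteq> Rm m. Y = zero_locus m S)"

definition irreducible_closed :: "nat \<Rightarrow> (nat \<Rightarrow> complex) set \<Rightarrow> bool" where
  "irreducible_closed m Y \<longleftrightarrow> zariski_closed m Y \<and> Y \<noteq> {} \<and>
     (\<forall>A B. zariski_closed m A \<and> zariski_closed m B \<and> Y \<subseteq> A \<union> B \<longrightarrow> Y \<subseteq> A \<or> Y \<subseteq> B)"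

definition alg_dim :: "nat \<Rightarrow> (nat \<Rightarrow> complex) set \<Rightarrow> int" where
  "alg_dim m Z = (if Z = {} then -1 else int (Sup {d. \<exists>Y :: nat \<Rightarrow> (nat \<Rightarrow> complex) set.
       (\<forall>i\<le>d. irreducible_closed m (Y i) \<and> Y i \<subseteq> Z) \<and> (\<forall>i<d. Y i \<subset> Y (Suc i))}))"

text \<open>A form is given by its coefficients in the standard basis: the coefficient of
  dx_(j_1) \<and> ... \<and> dx_(j_r) (j_1 < ... < j_r) is stored at the set {j_1,...,j_r}.\<close>
type_synonym mform = "nat set \<Rightarrow> mpoly"

definition is_form :: "nat \<Rightarrow> int \<Rightarrow> mform \<Rightarrow> bool" where
  "is_form m r \<alpha> \<longleftrightarrow> (\<forall>J. \<alpha> J \<noteq> 0 \<longrightarrow> J \<subseteq> {..<m} \<and> int (card J) = r) \<and>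
     (\<forall>J. \<alpha> J \<in> Rm m)"

definition wedge :: "mform \<Rightarrow> mform \<Rightarrow> mform" where
  "wedge \<alpha> \<beta> K = (\<Sum>A\<in>Pow K.
      (- 1) ^ card {(a, b). a \<in> A \<and> b \<in> K - A \<and> b < a} * \<alpha> A * \<beta> (K - A))"

definition dpoly :: "nat \<Rightarrow> mpoly \<Rightarrow> mform" where
  "dpoly m D J = (if \<exists>j<m. J = {j} then mpderiv (the_elem J) D else 0)"

definition wedge_dD :: "nat \<Rightarrow> mform \<Rightarrow> mpoly list \<Rightarrow> mform" where
  "wedge_dD m \<alpha> Ds = foldl wedge \<alpha> (map (dpoly m) Ds)"

definition form_eq_mod :: "mpoly set \<Rightarrow> mform \<Rightarrow> mform \<Rightarrow> bool" where
  "form_eq_mod I \<beta> \<gamma> \<longleftrightarrow> (\<forall>J. \<beta> J - \<gamma> J \<in> I)"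

end

theory Submission
  imports Defs "HOL-Analysis.Continuum_Not_Denumerable"
    "HOL-Computational_Algebra.Fundamental_Theorem_Algebra"
    "HOL-Computational_Algebra.Primes"
begin

text \<open>The form is glued one component at a time. If \<open>\<omega>\<close> solves the problem for
  \<open>I\<^sub>1, \<dots>, I\<^sub>i\<close>, then each coefficient of
  \<open>\<omega> - \<alpha>\<^sub>i\<^sub>+\<^sub>1 \<and> dD\<^sub>1 \<and> \<dots> \<and> dD\<^sub>k\<close> vanishes on the common zeros of
  \<open>J\<^sub>i + I\<^sub>i\<^sub>+\<^sub>1\<close>: such a point lies on two components, and at a point where
  \<open>dD\<^sub>1 \<and> \<dots> \<and> dD\<^sub>k \<noteq> 0\<close> the ideal \<open>I\<close> is locally prime, so that only one component
  passes through it. By the Nullstellensatz the coefficient lies in the radical ideal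
  \<open>J\<^sub>i + I\<^sub>i\<^sub>+\<^sub>1\<close>, and subtracting its \<open>J\<^sub>i\<close> part from \<open>\<omega>\<close> corrects the form.

  Local primality is obtained from the substitution \<open>\<sigma> x = x - \<Sum>\<^sub>l D\<^sub>l v\<^sub>l\<close>, where the \<open>v\<^sub>l\<close> are
  dual to the differentials at the point, with maximal ideal \<open>\<mm>\<close>. It is the identity modulo
  \<open>I\<close>, and its \<open>n\<close>-th iterate sends \<open>I\<close> into \<open>\<mm>\<^sup>n\<^sup>+\<^sup>1\<close>. With Krull's intersection theorem,
  \<open>f\<close> vanishes in the local ring iff \<open>\<sigma>\<^sup>n f \<in> \<mm>\<^sup>n\<^sup>+\<^sup>1\<close> for all \<open>n\<close>; for any other \<open>f\<close> the
  order of \<open>\<sigma>\<^sup>n f\<close> is eventually constant, and orders are additive.\<close>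

abbreviation keys :: "('a \<Rightarrow>\<^sub>0 'b::zero) \<Rightarrow> 'a set" where
  "keys \<equiv> Poly_Mapping.keys"

abbreviation lookup :: "('a \<Rightarrow>\<^sub>0 'b::zero) \<Rightarrow> 'a \<Rightarrow> 'b" where
  "lookup \<equiv> Poly_Mapping.lookup"

abbreviation single :: "'a \<Rightarrow> 'b \<Rightarrow> 'a \<Rightarrow>\<^sub>0 'b::zero" where
  "single \<equiv> Poly_Mapping.single"

subsection \<open>Evaluation homomorphisms\<close>

lemma poly_mapping_sum_single:
  fixes p :: "'a \<Rightarrow>\<^sub>0 'b::comm_monoid_add"
  shows "p = (\<Sum>\<mu>\<in>keys p. single \<mu> (lookup p \<mu>))"
  by (rule poly_mapping_eqI)
     (auto simp: lookup_sum lookup_single when_def in_keys_iff)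

text \<open>Keeping \<open>\<mu> \<in> keys p\<close> lets an induction on an element of
  \<open>Rm m\<close> meet only monomials in the first \<open>m\<close> variables.\<close>

lemma mpoly_single_induct [case_names zero add]:
  fixes p :: "'a \<Rightarrow>\<^sub>0 'b::comm_monoid_add"
  assumes "P 0" and "\<And>q \<mu> c. P q \<Longrightarrow> \<mu> \<in> keys p \<Longrightarrow> P (q + single \<mu> c)"
  shows "P p"
proof -
  have "P (\<Sum>\<mu>\<in>A. single \<mu> (lookup p \<mu>))" if "A \<subseteq> keys p" for A
    using finite_subset[OF that finite_keys] that
  proof induction
    case (insert \<mu> A)
    then show ?case
      using assms(2)[of "\<Sum>\<mu>\<in>A. single \<mu> (lookup p \<mu>)" \<mu> "lookup p \<mu>"] by (simp add: add.commute)
  qed (simp add: assms)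
  from this[of "keys p"] show ?thesis
    using poly_mapping_sum_single[of p] by simp
qed

definition monom_ev :: "(nat \<Rightarrow> 'b::comm_monoid_mult) \<Rightarrow> (nat \<Rightarrow>\<^sub>0 nat) \<Rightarrow> 'b" where
  "monom_ev \<phi> \<mu> = (\<Prod>j\<in>keys \<mu>. \<phi> j ^ lookup \<mu> j)"

text \<open>One construction for two homomorphisms: \<open>h = cst\<close> gives substitution of
  polynomials, the identity gives evaluation at a point.\<close>

definition peval :: "(complex \<Rightarrow> 'b::comm_ring_1) \<Rightarrow> (nat \<Rightarrow> 'b) \<Rightarrow> mpoly \<Rightarrow> 'b" where
  "peval h \<phi> p = (\<Sum>\<mu>\<in>keys p. h (lookup p \<mu>) * monom_ev \<phi> \<mu>)"

lemma monom_ev_superset: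
  assumes "finite A" "keys \<mu> \<subseteq> A"
  shows "monom_ev \<phi> \<mu> = (\<Prod>j\<in>A. \<phi> j ^ lookup \<mu> j)"
  unfolding monom_ev_def
  by (rule prod.mono_neutral_left) (use assms in \<open>auto simp: in_keys_iff\<close>)

lemma monom_ev_0 [simp]: "monom_ev \<phi> 0 = 1"
  by (simp add: monom_ev_def)

lemma monom_ev_add: "monom_ev \<phi> (\<mu> + \<nu>) = monom_ev \<phi> \<mu> * monom_ev \<phi> \<nu>"
proof -
  let ?A = "keys \<mu> \<union> keys \<nu>"
  have "keys (\<mu> + \<nu>) \<subseteq> ?A"
    by (rule keys_add)
  then show ?thesis
    by (simp add: monom_ev_superset[of ?A] lookup_add power_add prod.distrib)
qed

lemma monom_ev_single [simp]: "monom_ev \<phi> (single j e) = \<phi> j ^ e"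
  by (cases "e = 0") (auto simp: monom_ev_def)

locale coeff_hom =
  fixes h :: "complex \<Rightarrow> 'b::comm_ring_1"
  assumes hom_add: "h (a + b) = h a + h b"
    and hom_mult: "h (a * b) = h a * h b"
    and hom_one: "h 1 = 1"
begin

lemma hom_zero: "h 0 = 0"
  using hom_add[of 0 0] by simp

lemma peval_superset:
  assumes "finite A" "keys p \<subseteq> A"
  shows "peval h \<phi> p = (\<Sum>\<mu>\<in>A. h (lookup p \<mu>) * monom_ev \<phi> \<mu>)"
  unfolding peval_def
  by (rule sum.mono_neutral_left) (use assms in \<open>auto simp: in_keys_iff hom_zero\<close>)

lemma peval_zero: "peval h \<phi> 0 = 0"
  by (simp add: peval_def)

lemma peval_add: "peval h \<phi> (p + q) = peval h \<phi> p + peval h \<phi> q"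
proof -
  let ?A = "keys p \<union> keys q"
  have "keys (p + q) \<subseteq> ?A"
    by (rule keys_add)
  then show ?thesis
    by (simp add: peval_superset[of ?A] lookup_add hom_add algebra_simps sum.distrib)
qed

lemma peval_single: "peval h \<phi> (single \<mu> c) = h c * monom_ev \<phi> \<mu>"
  by (cases "c = 0") (auto simp: peval_def hom_zero)

lemma peval_one: "peval h \<phi> 1 = 1"
  using peval_single[of \<phi> 0 1] by (simp add: hom_one)

lemma peval_mult: "peval h \<phi> (p * q) = peval h \<phi> p * peval h \<phi> q"
proof (induction p rule: mpoly_single_induct)
  case (add p \<mu> c)
  have "peval h \<phi> (single \<mu> c * q) = peval h \<phi> (single \<mu> c) * peval h \<phi> q"
    by (induction q rule: mpoly_single_induct)
       (simp_all add: peval_zero peval_add distrib_left mult_single peval_single monom_ev_add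
          hom_mult mult_ac)
  with add show ?case
    by (simp add: peval_add distrib_right)
qed (simp add: peval_zero)

lemma peval_uminus: "peval h \<phi> (- p) = - peval h \<phi> p"
  using peval_add[of \<phi> p "- p"] by (simp add: peval_zero eq_neg_iff_add_eq_0 add.commute)

lemma peval_diff: "peval h \<phi> (p - q) = peval h \<phi> p - peval h \<phi> q"
  using peval_add[of \<phi> p "- q"] by (simp add: peval_uminus)

lemma peval_power: "peval h \<phi> (p ^ n) = peval h \<phi> p ^ n"
  by (induction n) (simp_all add: peval_one peval_mult)

lemma peval_sum: "peval h \<phi> (sum f A) = (\<Sum>a\<in>A. peval h \<phi> (f a))"
  by (induction A rule: infinite_finite_induct) (simp_all add: peval_zero peval_add)

lemma peval_prod: "peval h \<phi> (prod f A) = (\<Prod>a\<in>A. peval h \<phi> (f a))"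
  by (induction A rule: infinite_finite_induct) (simp_all add: peval_one peval_mult)

lemma peval_mvar: "peval h \<phi> (mvar j) = \<phi> j"
  by (simp add: mvar_def peval_single hom_one)

end

section \<open>Substitution and evaluation as instances of one homomorphism\<close>

definition cst :: "complex \<Rightarrow> mpoly" where
  "cst c = single 0 c"

definition subst :: "(nat \<Rightarrow> mpoly) \<Rightarrow> mpoly \<Rightarrow> mpoly" where
  "subst = peval cst"

interpretation cst: coeff_hom cst
  by standard (simp_all add: cst_def single_add mult_single)

interpretation ident: coeff_hom "\<lambda>c::complex. c"
  by standard simp_all

lemma meval_eq_peval: "meval p x = peval (\<lambda>c. c) x p"
  by (simp add: meval_def peval_def monom_ev_def)

lemmas subst_simps =
  cst.peval_zero[folded subst_def] cst.peval_one[folded subst_def]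
  cst.peval_add[folded subst_def] cst.peval_mult[folded subst_def]
  cst.peval_uminus[folded subst_def] cst.peval_diff[folded subst_def]
  cst.peval_power[folded subst_def] cst.peval_sum[folded subst_def]
  cst.peval_prod[folded subst_def] cst.peval_mvar[folded subst_def]

lemmas subst_single = cst.peval_single[folded subst_def]

lemmas meval_simps =
  ident.peval_zero[folded meval_eq_peval] ident.peval_one[folded meval_eq_peval]
  ident.peval_add[folded meval_eq_peval] ident.peval_mult[folded meval_eq_peval]
  ident.peval_uminus[folded meval_eq_peval] ident.peval_diff[folded meval_eq_peval]
  ident.peval_power[folded meval_eq_peval] ident.peval_sum[folded meval_eq_peval]
  ident.peval_prod[folded meval_eq_peval] ident.peval_mvar[folded meval_eq_peval]

lemmas meval_single = ident.peval_single[folded meval_eq_peval]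

lemma subst_cst [simp]: "subst \<phi> (cst c) = cst c"
  by (simp add: cst_def[of c] subst_single)

lemma meval_cst [simp]: "meval (cst c) x = c"
  by (simp add: cst_def meval_single)

lemma cst_simps [simp]: "cst 0 = 0" "cst 1 = 1"
  "cst (a + b) = cst a + cst b" "cst (a * b) = cst a * cst b"
  by (simp_all add: cst.hom_zero cst.hom_add cst.hom_mult cst.hom_one)

lemma cst_uminus [simp]: "cst (- a) = - cst a"
  by (simp add: cst_def single_uminus)

lemma cst_diff [simp]: "cst (a - b) = cst a - cst b"
  by (simp add: cst_def single_diff)

lemma monom_ev_mvar: "monom_ev mvar \<mu> = single \<mu> 1"
proof -
  have power: "mvar j ^ e = single (single j e) 1" for j e
    by (induction e) (simp_all add: mvar_def mult_single single_add[symmetric])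
  have "(\<Prod>j\<in>A. single (single j (e j)) 1 :: mpoly) = single (\<Sum>j\<in>A. single j (e j)) 1"
    if "finite A" for A and e :: "nat \<Rightarrow> nat"
    using that by induction (simp_all add: mult_single)
  then show ?thesis
    using poly_mapping_sum_single[of \<mu>] by (simp add: monom_ev_def power)
qed

lemma single_eq_cst_times: "single \<mu> c = cst c * monom_ev mvar \<mu>"
  by (simp add: monom_ev_mvar cst_def mult_single)

lemma subst_mvar: "subst mvar p = p"
  by (induction p rule: mpoly_single_induct)
     (simp_all add: subst_simps subst_single single_eq_cst_times[symmetric])

lemma subst_subst: "subst \<phi> (subst \<psi> p) = subst (\<lambda>j. subst \<phi> (\<psi> j)) p"
  by (induction p rule: mpoly_single_induct)
     (simp_all add: subst_simps subst_single monom_ev_def)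

lemma meval_subst: "meval (subst \<phi> p) x = meval p (\<lambda>j. meval (\<phi> j) x)"
  by (induction p rule: mpoly_single_induct)
     (simp_all add: subst_simps subst_single meval_simps meval_single monom_ev_def)

subsection \<open>The ring in finitely many variables and its ideals\<close>

lemma Rm_single: "keys \<mu> \<subseteq> {..<m} \<Longrightarrow> single \<mu> c \<in> Rm m"
  by (cases "c = 0") (auto simp: Rm_def)

lemma Rm_zero [simp]: "0 \<in> Rm m"
  by (simp add: Rm_def)

lemma Rm_cst [simp]: "cst c \<in> Rm m"
  by (simp add: cst_def Rm_single)

lemma Rm_one [simp]: "1 \<in> Rm m"
  using Rm_cst[of 1 m] by simp

lemma Rm_add: "p \<in> Rm m \<Longrightarrow> q \<in> Rm m \<Longrightarrow> p + q \<in> Rm m"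
  using keys_add[of p q] unfolding Rm_def by blast

lemma Rm_mult: "p \<in> Rm m \<Longrightarrow> q \<in> Rm m \<Longrightarrow> p * q \<in> Rm m"
  unfolding Rm_def
proof (intro CollectI ballI)
  fix \<mu> assume *: "p \<in> {p. \<forall>\<mu>\<in>keys p. keys \<mu> \<subseteq> {..<m}}" "q \<in> {p. \<forall>\<mu>\<in>keys p. keys \<mu> \<subseteq> {..<m}}"
    and "\<mu> \<in> keys (p * q)"
  then obtain a b where ab: "\<mu> = a + b" "a \<in> keys p" "b \<in> keys q"
    using keys_mult[of p q] by blast
  with * show "keys \<mu> \<subseteq> {..<m}"
    using keys_add[of a b] by blast
qed

lemma Rm_uminus: "p \<in> Rm m \<Longrightarrow> - p \<in> Rm m"
  using Rm_mult[of "cst (-1)" m p] Rm_cst[of "-1" m] by simp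

lemma Rm_diff: "p \<in> Rm m \<Longrightarrow> q \<in> Rm m \<Longrightarrow> p - q \<in> Rm m"
  using Rm_add[of p m "- q"] Rm_uminus[of q m] by simp

lemma Rm_sum: "(\<And>a. a \<in> A \<Longrightarrow> f a \<in> Rm m) \<Longrightarrow> sum f A \<in> Rm m"
  by (induction A rule: infinite_finite_induct) (simp_all add: Rm_add)

lemma Rm_prod: "(\<And>a. a \<in> A \<Longrightarrow> f a \<in> Rm m) \<Longrightarrow> prod f A \<in> Rm m"
  by (induction A rule: infinite_finite_induct) (simp_all add: Rm_mult)

lemma Rm_power: "p \<in> Rm m \<Longrightarrow> p ^ n \<in> Rm m"
  by (induction n) (simp_all add: Rm_mult)

lemma Rm_mvar: "j < m \<Longrightarrow> mvar j \<in> Rm m"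
  by (simp add: mvar_def Rm_single)

lemmas Rm_intros = Rm_zero Rm_one Rm_cst Rm_add Rm_mult Rm_uminus Rm_diff Rm_sum Rm_prod
  Rm_power Rm_mvar

lemma Rm_keys: "p \<in> Rm m \<Longrightarrow> \<mu> \<in> keys p \<Longrightarrow> keys \<mu> \<subseteq> {..<m}"
  by (simp add: Rm_def)

text \<open>Monomials are built up from a constant one variable at a time, so product-rule arguments
  need no exponents.\<close>

lemma Rm_induct [consumes 1, case_names cst add mult]:
  assumes "p \<in> Rm m"
    and cst: "\<And>c. P (cst c)"
    and add: "\<And>p q. p \<in> Rm m \<Longrightarrow> q \<in> Rm m \<Longrightarrow> P p \<Longrightarrow> P q \<Longrightarrow> P (p + q)"
    and mult: "\<And>p j. p \<in> Rm m \<Longrightarrow> j < m \<Longrightarrow> P p \<Longrightarrow> P (mvar j * p)"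
  shows "P p"
proof -
  have pow: "mvar j ^ e * q \<in> Rm m \<and> P (mvar j ^ e * q)" if "q \<in> Rm m" "P q" "j < m" for q j e
    by (induction e) (use that in \<open>auto simp: mult.assoc intro: mult Rm_intros\<close>)
  have prod: "cst c * (\<Prod>j\<in>A. mvar j ^ e j) \<in> Rm m \<and> P (cst c * (\<Prod>j\<in>A. mvar j ^ e j))"
    if "A \<subseteq> {..<m}" for A c and e :: "nat \<Rightarrow> nat"
    using finite_subset[OF that finite_lessThan] that
  proof (induction)
    case (insert j A)
    have "cst c * (\<Prod>j\<in>insert j A. mvar j ^ e j) = mvar j ^ e j * (cst c * (\<Prod>j\<in>A. mvar j ^ e j))"
      using insert.hyps by (simp add: mult_ac)
    then show ?case
      using pow[of "cst c * (\<Prod>j\<in>A. mvar j ^ e j)" j "e j"] insert by (simp only:) simp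
  qed (simp add: cst)
  have "p \<in> Rm m \<and> P p"
  proof (induction p rule: mpoly_single_induct)
    case zero
    then show ?case
      using cst[of 0] by simp
  next
    case (add q \<mu> c)
    then show ?case
      using prod[of "keys \<mu>" c "lookup \<mu>"] Rm_keys[of p m \<mu>] assms(1,3)
      by (auto simp: single_eq_cst_times monom_ev_def intro: Rm_add)
  qed
  then show ?thesis ..
qed

lemma subst_Rm:
  assumes "p \<in> Rm m" "\<And>j. j < m \<Longrightarrow> \<phi> j \<in> Rm n"
  shows "subst \<phi> p \<in> Rm n"
  using assms(1) by (induction rule: Rm_induct) (auto simp: subst_simps intro: Rm_intros assms(2))

lemma ideal_subset: "is_ideal m J \<Longrightarrow> a \<in> J \<Longrightarrow> a \<in> Rm m"
  and ideal_zero: "is_ideal m J \<Longrightarrow> 0 \<in> J"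
  and ideal_add: "is_ideal m J \<Longrightarrow> a \<in> J \<Longrightarrow> b \<in> J \<Longrightarrow> a + b \<in> J"
  and ideal_mult: "is_ideal m J \<Longrightarrow> r \<in> Rm m \<Longrightarrow> a \<in> J \<Longrightarrow> r * a \<in> J"
  by (auto simp: is_ideal_def)

lemma ideal_mult_right: "is_ideal m J \<Longrightarrow> r \<in> Rm m \<Longrightarrow> a \<in> J \<Longrightarrow> a * r \<in> J"
  using ideal_mult[of m J r a] by (simp add: mult.commute)

lemma ideal_uminus: "is_ideal m J \<Longrightarrow> a \<in> J \<Longrightarrow> - a \<in> J"
  using ideal_mult[of m J "cst (-1)" a] Rm_cst[of "-1" m] by simp

lemma ideal_diff: "is_ideal m J \<Longrightarrow> a \<in> J \<Longrightarrow> b \<in> J \<Longrightarrow> a - b \<in> J"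
  using ideal_add[of m J a "- b"] ideal_uminus[of m J b] by simp

lemma ideal_setsum: "is_ideal m J \<Longrightarrow> (\<And>a. a \<in> A \<Longrightarrow> f a \<in> J) \<Longrightarrow> sum f A \<in> J"
  by (induction A rule: infinite_finite_induct) (auto intro: ideal_zero ideal_add)

lemma ideal_power_ge: "is_ideal m J \<Longrightarrow> a \<in> Rm m \<Longrightarrow> a ^ k \<in> J \<Longrightarrow> k \<le> l \<Longrightarrow> a ^ l \<in> J"
  using ideal_mult[of m J "a ^ (l - k)" "a ^ k"] by (simp add: Rm_power power_add[symmetric])

lemma is_ideal_Rm: "is_ideal m (Rm m)"
  by (auto simp: is_ideal_def intro: Rm_intros)

lemma ideal_sum_superset:
  assumes "is_ideal m A" "is_ideal m B"
  shows "A \<subseteq> ideal_sum A B" "B \<subseteq> ideal_sum A B"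
  using ideal_zero[OF assms(1)] ideal_zero[OF assms(2)]
  by (force simp: ideal_sum_def)+

lemma is_ideal_ideal_sum:
  assumes A: "is_ideal m A" and B: "is_ideal m B"
  shows "is_ideal m (ideal_sum A B)"
  unfolding is_ideal_def
proof (intro conjI ballI)
  show "ideal_sum A B \<subseteq> Rm m"
    by (auto simp: ideal_sum_def intro: Rm_add ideal_subset[OF A] ideal_subset[OF B])
  show "0 \<in> ideal_sum A B"
    using ideal_sum_superset[OF A B] ideal_zero[OF A] by blast
next
  fix x y assume "x \<in> ideal_sum A B" "y \<in> ideal_sum A B"
  then obtain a b c d where "x = a + b" "y = c + d" "a \<in> A" "b \<in> B" "c \<in> A" "d \<in> B"
    by (auto simp: ideal_sum_def)
  then have "x + y = (a + c) + (b + d)" "a + c \<in> A" "b + d \<in> B"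
    by (auto intro: ideal_add A B)
  then show "x + y \<in> ideal_sum A B"
    unfolding ideal_sum_def by blast
next
  fix r x assume r: "r \<in> Rm m" and "x \<in> ideal_sum A B"
  then obtain a b where "x = a + b" "a \<in> A" "b \<in> B"
    by (auto simp: ideal_sum_def)
  then have "r * x = r * a + r * b" "r * a \<in> A" "r * b \<in> B"
    by (auto intro: ideal_mult A B r simp: distrib_left)
  then show "r * x \<in> ideal_sum A B"
    unfolding ideal_sum_def by blast
qed

definition ideal_times :: "mpoly set \<Rightarrow> mpoly \<Rightarrow> mpoly set" where
  "ideal_times J a = (\<lambda>r. r * a) ` J"

lemma is_ideal_ideal_times:
  assumes J: "is_ideal m J" and "a \<in> Rm m"
  shows "is_ideal m (ideal_times J a)"
  unfolding is_ideal_def ideal_times_def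
proof (intro conjI ballI)
  fix x y assume "x \<in> (\<lambda>r. r * a) ` J" "y \<in> (\<lambda>r. r * a) ` J"
  then obtain r s where "r \<in> J" "s \<in> J" "x + y = (r + s) * a"
    by (auto simp: distrib_right)
  then show "x + y \<in> (\<lambda>r. r * a) ` J"
    by (auto intro: ideal_add[OF J])
next
  fix t x assume "t \<in> Rm m" "x \<in> (\<lambda>r. r * a) ` J"
  then obtain r where "r \<in> J" "t * x = (t * r) * a"
    by (auto simp: mult.assoc)
  with \<open>t \<in> Rm m\<close> show "t * x \<in> (\<lambda>r. r * a) ` J"
    by (auto intro!: image_eqI[of _ _ "t * r"] ideal_mult[OF J])
next
  show "0 \<in> (\<lambda>r. r * a) ` J"
    by (rule image_eqI[of _ _ 0]) (simp_all add: ideal_zero[OF J])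
qed (auto intro: Rm_mult assms(2) ideal_subset[OF J])

lemma ideal_times_Rm_self: "a \<in> ideal_times (Rm m) a"
  by (auto simp: ideal_times_def intro: image_eqI[of _ _ 1])

lemma ideal_sum_timesE:
  assumes "x \<in> ideal_sum J (ideal_times K a)"
  obtains u r where "u \<in> J" "r \<in> K" "x = u + r * a"
  using assms by (auto simp: ideal_sum_def ideal_times_def)

lemma is_ideal_ideal_gen: "S \<subseteq> Rm m \<Longrightarrow> is_ideal m (ideal_gen m S)"
  using is_ideal_Rm[of m] by (auto simp: is_ideal_def ideal_gen_def)

lemma ideal_gen_superset: "S \<subseteq> ideal_gen m S"
  by (auto simp: ideal_gen_def)

lemma ideal_gen_least: "is_ideal m J \<Longrightarrow> S \<subseteq> J \<Longrightarrow> ideal_gen m S \<subseteq> J"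
  by (auto simp: ideal_gen_def)

lemma is_ideal_ideal_Inter:
  assumes "\<And>i. i \<in> A \<Longrightarrow> is_ideal m (Is i)"
  shows "is_ideal m (ideal_Inter m A Is)"
  using assms unfolding ideal_Inter_def is_ideal_def by (auto intro: Rm_intros)

subsection \<open>Ascending chain condition\<close>

text \<open>Comparing Goedel numbers is a multiplicative well-order on monomials, so it serves as the
  monomial order.\<close>
definition goedel :: "(nat \<Rightarrow>\<^sub>0 nat) \<Rightarrow> nat" where
  "goedel = monom_ev (enumerate {p. prime p})"

lemma goedel_add: "goedel (\<mu> + \<nu>) = goedel \<mu> * goedel \<nu>"
  by (simp add: goedel_def monom_ev_add)

lemma prime_enumerate: "prime (enumerate {p::nat. prime p} j)"
  using enumerate_in_set[OF primes_infinite, of j] by simp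

lemma goedel_pos: "goedel \<mu> > 0"
  unfolding goedel_def monom_ev_def
  by (intro prod_pos) (simp add: prime_gt_0_nat prime_enumerate)

lemma inj_goedel: "inj goedel"
proof (rule injI)
  let ?e = "enumerate {p::nat. prime p}"
  fix \<mu> \<nu> assume eq: "goedel \<mu> = goedel \<nu>"
  have inj: "inj ?e"
    using strict_mono_enumerate[OF primes_infinite] by (rule strict_mono_imp_inj_on)
  have mult: "multiplicity (?e j) (goedel \<mu>) = lookup \<mu> j" for j \<mu>
  proof -
    have "goedel \<mu> = (\<Prod>p\<in>?e ` keys \<mu>. p ^ lookup \<mu> (inv ?e p))"
      unfolding goedel_def monom_ev_def
      by (subst prod.reindex) (auto intro: inj_on_subset[OF inj] simp: inv_f_f[OF inj])
    also have "multiplicity (?e j) \<dots> = (if ?e j \<in> ?e ` keys \<mu> then lookup \<mu> (inv ?e (?e j)) else 0)"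
      by (rule multiplicity_prod_prime_powers) (auto simp: prime_enumerate)
    also have "\<dots> = lookup \<mu> j"
      by (auto simp: inv_f_f[OF inj] inj_image_mem_iff[OF inj] in_keys_iff)
    finally show ?thesis .
  qed
  show "\<mu> = \<nu>"
    by (rule poly_mapping_eqI) (metis eq mult)
qed

lemma lookup_single_mult:
  fixes p :: "'a::cancel_comm_monoid_add \<Rightarrow>\<^sub>0 'b::comm_semiring_0"
  shows "lookup (single \<nu> c * p) (\<nu> + \<mu>) = c * lookup p \<mu>"
  by (induction p rule: mpoly_single_induct)
     (simp_all add: distrib_left mult_single lookup_add lookup_single when_def)

lemma keys_single_mult:
  fixes p :: "'a::cancel_comm_monoid_add \<Rightarrow>\<^sub>0 'b::comm_semiring_0"
  shows "keys (single \<nu> c * p) \<subseteq> (+) \<nu> ` keys p"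
  using keys_mult[of "single \<nu> c" p] by (force split: if_splits)

definition is_lead :: "(nat \<Rightarrow>\<^sub>0 nat) \<Rightarrow> mpoly \<Rightarrow> bool" where
  "is_lead \<mu> p \<longleftrightarrow> \<mu> \<in> keys p \<and> (\<forall>\<nu>\<in>keys p. goedel \<nu> \<le> goedel \<mu>)"

lemma is_lead_exists:
  assumes "p \<noteq> 0"
  obtains \<mu> where "is_lead \<mu> p"
proof -
  have ne: "keys p \<noteq> {}"
    using assms poly_mapping_sum_single[of p] by auto
  have "Max (goedel ` keys p) \<in> goedel ` keys p"
    by (rule Max_in) (use ne in auto)
  then obtain \<mu> where "\<mu> \<in> keys p" "goedel \<mu> = Max (goedel ` keys p)"
    by auto
  then have "is_lead \<mu> p"
    by (auto simp: is_lead_def)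
  with that show ?thesis .
qed

text \<open>One division step: the coefficient is chosen so that the leading terms cancel, and
  injectivity of \<open>goedel\<close> makes the drop strict.\<close>

lemma lead_reduction:
  assumes p: "is_lead \<mu> p" and q: "is_lead (\<nu> + \<mu>) q"
  defines "q' \<equiv> q - single \<nu> (lookup q (\<nu> + \<mu>) / lookup p \<mu>) * p"
  assumes "\<kappa> \<in> keys q'"
  shows "goedel \<kappa> < goedel (\<nu> + \<mu>)"
proof -
  let ?c = "lookup q (\<nu> + \<mu>) / lookup p \<mu>"
  have "lookup p \<mu> \<noteq> 0"
    using p by (auto simp: is_lead_def in_keys_iff)
  then have "lookup q' (\<nu> + \<mu>) = 0"
    by (simp add: q'_def lookup_minus lookup_single_mult)
  then have ne: "\<kappa> \<noteq> \<nu> + \<mu>"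
    using assms(4) by (auto simp: in_keys_iff)
  have "\<kappa> \<in> keys q \<or> \<kappa> \<in> keys (single \<nu> ?c * p)"
    using assms(4) by (auto simp: q'_def in_keys_iff lookup_minus)
  then have "goedel \<kappa> \<le> goedel (\<nu> + \<mu>)"
  proof
    assume "\<kappa> \<in> keys (single \<nu> ?c * p)"
    then obtain \<kappa>' where "\<kappa> = \<nu> + \<kappa>'" "\<kappa>' \<in> keys p"
      using keys_single_mult[of \<nu> ?c p] by blast
    then show ?thesis
      using p by (simp add: is_lead_def goedel_add)
  qed (use q in \<open>simp add: is_lead_def\<close>)
  moreover have "goedel \<kappa> \<noteq> goedel (\<nu> + \<mu>)"
    using ne inj_goedel by (auto dest: injD)
  ultimately show ?thesis
    by simp
qed

section \<open>Dickson's lemma on exponent vectors\<close>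

lemma incseq_subsequence_nat:
  fixes s :: "nat \<Rightarrow> nat"
  obtains r :: "nat \<Rightarrow> nat" where "strict_mono r" "incseq (s \<circ> r)"
proof -
  obtain f where f: "strict_mono f" "monoseq (\<lambda>n. s (f n))"
    using seq_monosub by blast
  from f(2) consider "incseq (\<lambda>n. s (f n))" | "decseq (\<lambda>n. s (f n))"
    by (auto simp: monoseq_iff)
  then show thesis
  proof cases
    case 1
    with f that show thesis by (simp add: o_def)
  next
    case 2
    \<comment> \<open>A decreasing sequence of naturals is constant from an index at which its least
      value is attained.\<close>
    obtain n where n: "\<And>k. s (f n) \<le> s (f k)"
      using ex_has_least_nat[of "\<lambda>_. True" 0 "\<lambda>n. s (f n)"] by auto
    have "s (f (k + n)) = s (f n)" for k
      using decseqD[OF 2, of n "k + n"] n[of "k + n"] by simp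
    then have "incseq (s \<circ> (\<lambda>k. f (k + n)))"
      by (simp add: incseq_def)
    moreover have "strict_mono (\<lambda>k. f (k + n))"
      using f(1) by (simp add: strict_mono_def)
    ultimately show thesis
      using that by blast
  qed
qed

text \<open>The subsequence is refined one coordinate at a time; coordinates treated earlier stay
  monotone.\<close>

lemma Dickson_subsequence:
  fixes s :: "nat \<Rightarrow> nat \<Rightarrow> nat"
  shows "\<exists>r::nat \<Rightarrow> nat. strict_mono r \<and> (\<forall>j<m. incseq (\<lambda>i. s (r i) j))"
proof (induction m)
  case 0
  show ?case
    by (rule exI[of _ id]) (simp add: strict_mono_def)
next
  case (Suc m)
  then obtain r :: "nat \<Rightarrow> nat" where r: "strict_mono r" "\<And>j. j < m \<Longrightarrow> incseq (\<lambda>i. s (r i) j)"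
    by blast
  obtain t :: "nat \<Rightarrow> nat" where t: "strict_mono t" "incseq ((\<lambda>i. s (r i) m) \<circ> t)"
    using incseq_subsequence_nat .
  have "incseq (\<lambda>i. s (r (t i)) j)" if "j < Suc m" for j
  proof (cases "j = m")
    case False
    with that r(2)[of j] t(1) show ?thesis
      by (auto simp: incseq_def strict_mono_less_eq)
  qed (use t(2) in \<open>simp add: o_def\<close>)
  then show ?case
    using strict_mono_o[OF r(1) t(1)] by (auto simp: o_def)
qed

lemma Dickson_divides:
  fixes \<mu> :: "nat \<Rightarrow> nat \<Rightarrow>\<^sub>0 nat"
  assumes "\<And>i. keys (\<mu> i) \<subseteq> {..<m}"
  obtains a b \<nu> where "a < b" "\<mu> b = \<nu> + \<mu> a" "keys \<nu> \<subseteq> {..<m}"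
proof -
  obtain r :: "nat \<Rightarrow> nat" where r: "strict_mono r" "\<And>j. j < m \<Longrightarrow> incseq (\<lambda>i. lookup (\<mu> (r i)) j)"
    using Dickson_subsequence[of m "\<lambda>i. lookup (\<mu> i)"] by auto
  have le: "lookup (\<mu> (r 0)) j \<le> lookup (\<mu> (r 1)) j" for j
  proof (cases "j < m")
    case False
    then have "j \<notin> keys (\<mu> (r 0))"
      using assms by blast
    then show ?thesis by (simp add: in_keys_iff)
  qed (use incseqD[OF r(2), of j 0 1] in simp)
  define \<nu> where "\<nu> = \<mu> (r 1) - \<mu> (r 0)"
  have "\<mu> (r 1) = \<nu> + \<mu> (r 0)"
    using le by (intro poly_mapping_eqI) (simp add: \<nu>_def lookup_add lookup_minus)
  moreover have "keys \<nu> \<subseteq> keys (\<mu> (r 1))"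
    by (auto simp: \<nu>_def in_keys_iff lookup_minus)
  ultimately show thesis
    using assms[of "r 1"] strict_monoD[OF r(1), of 0 1] by (intro that[of "r 0" "r 1" \<nu>]) auto
qed

text \<open>Hilbert's basis theorem. Let \<open>\<mu> i\<close> be the least leading monomial of an
  element of \<open>J (Suc i) - J i\<close>. By Dickson some \<open>\<mu> a\<close> divides a later
  \<open>\<mu> b\<close>; subtracting a multiple of the element of
  \<open>J (Suc a) \<subseteq> J b\<close> lowers the leading monomial without leaving
  \<open>J (Suc b) - J b\<close>, a contradiction.\<close>

lemma no_strict_ideal_chain:
  assumes ideal: "\<And>i. is_ideal m (J i)" and strict: "\<And>i. J i \<subset> J (Suc i)"
  shows False
proof -
  have mono: "J a \<subseteq> J b" if "a \<le> b" for a b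
    using that by (rule lift_Suc_mono_le[of J, rotated]) (use strict in blast)
  define good where "good i \<mu> \<longleftrightarrow> (\<exists>p \<in> J (Suc i) - J i. is_lead \<mu> p)" for i \<mu>
  have "\<exists>\<mu>. good i \<mu> \<and> (\<forall>\<nu>. good i \<nu> \<longrightarrow> goedel \<mu> \<le> goedel \<nu>)" for i
  proof -
    obtain p where p: "p \<in> J (Suc i) - J i"
      using strict[of i] by auto
    then have "p \<noteq> 0"
      using ideal_zero[OF ideal[of i]] by auto
    with p obtain \<mu> where "good i \<mu>"
      using is_lead_exists unfolding good_def by blast
    then show ?thesis
      using ex_has_least_nat[of "good i" \<mu> goedel] by auto
  qed
  then obtain \<mu> where \<mu>: "\<And>i. good i (\<mu> i)" "\<And>i \<nu>. good i \<nu> \<Longrightarrow> goedel (\<mu> i) \<le> goedel \<nu>"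
    by metis
  have keys: "keys (\<mu> i) \<subseteq> {..<m}" for i
    using \<mu>(1)[of i] ideal_subset[OF ideal[of "Suc i"]]
    by (auto simp: good_def is_lead_def Rm_def)
  obtain a b \<nu> where ab: "a < b" "\<mu> b = \<nu> + \<mu> a" and \<nu>: "keys \<nu> \<subseteq> {..<m}"
    using Dickson_divides[of \<mu>, OF keys] .
  obtain p q where p: "p \<in> J (Suc a)" "is_lead (\<mu> a) p"
    and q: "q \<in> J (Suc b) - J b" "is_lead (\<nu> + \<mu> a) q"
    using \<mu>(1)[of a] \<mu>(1)[of b] ab(2) by (auto simp: good_def)
  define s where "s = single \<nu> (lookup q (\<nu> + \<mu> a) / lookup p (\<mu> a)) * p"
  have "p \<in> J b"
    using p(1) mono[of "Suc a" b] ab(1) by auto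
  then have s: "s \<in> J b"
    unfolding s_def by (intro ideal_mult[OF ideal] Rm_single \<nu>)
  have q': "q - s \<in> J (Suc b) - J b"
    using q(1) s mono[of b "Suc b"] ideal_diff[OF ideal, of q "Suc b" s]
      ideal_add[OF ideal, of "q - s" b s] by auto
  then have "q - s \<noteq> 0"
    using ideal_zero[OF ideal[of b]] by auto
  then obtain \<kappa> where \<kappa>: "is_lead \<kappa> (q - s)"
    by (rule is_lead_exists)
  then have "goedel \<kappa> < goedel (\<mu> b)"
    using lead_reduction[OF p(2) q(2)] ab(2) by (auto simp: s_def is_lead_def)
  moreover have "good b \<kappa>"
    using q' \<kappa> by (auto simp: good_def)
  ultimately show False
    using \<mu>(2)[of b \<kappa>] by simp
qed

lemma maximal_ideal_exists:
  assumes ideal: "\<And>J. J \<in> \<F> \<Longrightarrow> is_ideal m J" and J0: "J0 \<in> \<F>"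
  shows "\<exists>Q\<in>\<F>. \<forall>J\<in>\<F>. Q \<subseteq> J \<longrightarrow> J = Q"
proof (rule ccontr)
  assume "\<not> ?thesis"
  then have "\<forall>Q\<in>\<F>. \<exists>J\<in>\<F>. Q \<subset> J"
    by (simp add: psubset_eq) metis
  then obtain up where up: "\<And>Q. Q \<in> \<F> \<Longrightarrow> up Q \<in> \<F>" "\<And>Q. Q \<in> \<F> \<Longrightarrow> Q \<subset> up Q"
    by metis
  have in_F: "(up ^^ i) J0 \<in> \<F>" for i
    by (induction i) (simp_all add: J0 up(1))
  show False
  proof (rule no_strict_ideal_chain)
    show "is_ideal m ((up ^^ i) J0)" for i
      by (rule ideal[OF in_F])
    show "(up ^^ i) J0 \<subset> (up ^^ Suc i) J0" for i
      using up(2)[OF in_F[of i]] by simp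
  qed
qed

lemma ideal_chain_stabilises:
  assumes ideal: "\<And>i. is_ideal m (J i)" and mono: "incseq J"
  shows "\<exists>n. \<forall>k\<ge>n. J k = J n"
proof -
  have "\<exists>Q\<in>range J. \<forall>K\<in>range J. Q \<subseteq> K \<longrightarrow> K = Q"
    by (rule maximal_ideal_exists[of "range J" m "J 0"]) (use ideal in auto)
  then obtain n where "\<And>k. J n \<subseteq> J k \<Longrightarrow> J k = J n"
    by auto
  then show ?thesis
    using incseqD[OF mono] by blast
qed

subsection \<open>Nullstellensatz over an uncountable field\<close>

text \<open>Polynomials supported on \<open>T\<close> form a finite-dimensional space. A repeated
  value of \<open>g\<close> is treated separately, because independence of the image of
  \<open>S\<close> does not see repetitions.\<close>

lemma linear_dependence:
  fixes g :: "'c \<Rightarrow> mpoly"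
  assumes "infinite S" "finite T" and keys: "\<And>c. c \<in> S \<Longrightarrow> keys (g c) \<subseteq> T"
  shows "\<exists>A a. finite A \<and> A \<subseteq> S \<and> (\<exists>c\<in>A. a c \<noteq> 0) \<and> (\<Sum>c\<in>A. cst (a c) * g c) = 0"
proof (cases "inj_on g S")
  case False
  then obtain c d where cd: "c \<in> S" "d \<in> S" "c \<noteq> d" "g c = g d"
    by (auto simp: inj_on_def)
  show ?thesis
    by (rule exI[of _ "{c, d}"], rule exI[of _ "\<lambda>e. if e = c then 1 else -1"]) (use cd in simp)
next
  case True
  interpret vs: vector_space "\<lambda>c (p::mpoly). cst c * p"
    by standard (simp_all add: algebra_simps)
  let ?B = "(\<lambda>\<mu>. single \<mu> 1 :: mpoly) ` T"
  have "g c \<in> vs.span ?B" if "c \<in> S" for c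
  proof -
    have "cst (lookup (g c) \<mu>) * single \<mu> 1 \<in> vs.span ?B" if "\<mu> \<in> keys (g c)" for \<mu>
      using that keys[OF \<open>c \<in> S\<close>] by (intro vs.span_scale vs.span_base) auto
    then have "(\<Sum>\<mu>\<in>keys (g c). single \<mu> (lookup (g c) \<mu>)) \<in> vs.span ?B"
      by (intro vs.span_sum) (simp add: cst_def mult_single)
    then show ?thesis
      by (simp flip: poly_mapping_sum_single)
  qed
  moreover have "infinite (g ` S)"
    using assms(1) True by (simp add: finite_image_iff)
  ultimately have "vs.dependent (g ` S)"
    using vs.independent_span_bound[of ?B "g ` S"] assms(2) by auto
  then obtain t u where t: "finite t" "t \<subseteq> g ` S" "(\<Sum>v\<in>t. cst (u v) * v) = 0" "\<exists>v\<in>t. u v \<noteq> 0"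
    by (auto simp: vs.dependent_explicit)
  then obtain A where A: "A \<subseteq> S" "inj_on g A" "t = g ` A"
    by (auto simp: subset_image_inj)
  with t have "finite A" "(\<Sum>c\<in>A. cst (u (g c)) * g c) = 0" "\<exists>c\<in>A. u (g c) \<noteq> 0"
    by (auto simp: finite_image_iff sum.reindex)
  with A(1) show ?thesis
    by (intro exI[of _ A] exI[of _ "u \<circ> g"]) auto
qed

section \<open>Univariate polynomials evaluated at a ring element\<close>

definition upoly_ev :: "mpoly \<Rightarrow> complex poly \<Rightarrow> mpoly" where
  "upoly_ev x P = poly (map_poly cst P) x"

lemma upoly_ev_0 [simp]: "upoly_ev x 0 = 0"
  by (simp add: upoly_ev_def)

lemma upoly_ev_pCons [simp]: "upoly_ev x (pCons a P) = cst a + x * upoly_ev x P"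
  by (simp add: upoly_ev_def map_poly_pCons)

lemma upoly_ev_add: "upoly_ev x (P + Q) = upoly_ev x P + upoly_ev x Q"
proof -
  have "map_poly cst (P + Q) = map_poly cst P + map_poly cst Q"
    by (rule poly_eqI) (simp add: coeff_map_poly)
  then show ?thesis
    by (simp add: upoly_ev_def)
qed

lemma upoly_ev_smult: "upoly_ev x (smult c P) = cst c * upoly_ev x P"
  by (induction P) (simp_all add: algebra_simps)

lemma upoly_ev_mult: "upoly_ev x (P * Q) = upoly_ev x P * upoly_ev x Q"
  by (induction P) (simp_all add: upoly_ev_add upoly_ev_smult algebra_simps)

lemma upoly_ev_one [simp]: "upoly_ev x 1 = 1"
  by (simp add: one_pCons)

lemma upoly_ev_sum: "upoly_ev x (sum P A) = (\<Sum>a\<in>A. upoly_ev x (P a))"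
  by (induction A rule: infinite_finite_induct) (simp_all add: upoly_ev_add)

lemma upoly_ev_prod: "upoly_ev x (prod P A) = (\<Prod>a\<in>A. upoly_ev x (P a))"
  by (induction A rule: infinite_finite_induct) (simp_all add: upoly_ev_mult)

lemma upoly_ev_Rm: "x \<in> Rm m \<Longrightarrow> upoly_ev x P \<in> Rm m"
  by (induction P) (auto intro: Rm_intros)

section \<open>Prime ideals and roots\<close>

definition prime_idl :: "nat \<Rightarrow> mpoly set \<Rightarrow> bool" where
  "prime_idl m Q \<longleftrightarrow> is_ideal m Q \<and> 1 \<notin> Q \<and>
     (\<forall>a\<in>Rm m. \<forall>b\<in>Rm m. a * b \<in> Q \<longrightarrow> a \<in> Q \<or> b \<in> Q)"

lemma prime_idl_cst:
  assumes "prime_idl m Q" "cst c \<in> Q"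
  shows "c = 0"
proof (rule ccontr)
  assume "c \<noteq> 0"
  then have "cst (inverse c) * cst c = 1"
    using cst_simps(2,4) by (metis left_inverse)
  then have "1 \<in> Q"
    using assms ideal_mult[of m Q "cst (inverse c)" "cst c"] by (auto simp: prime_idl_def)
  with assms(1) show False
    by (simp add: prime_idl_def)
qed

text \<open>Over the complex numbers \<open>P\<close> splits off a linear factor; the prime ideal
  contains either this factor at \<open>x\<close> or the value of the cofactor, which has smaller
  degree.\<close>

lemma prime_idl_root:
  assumes Q: "prime_idl m Q" and x: "x \<in> Rm m" and "P \<noteq> 0" "upoly_ev x P \<in> Q"
  shows "\<exists>r. x - cst r \<in> Q"
  using assms(3,4)
proof (induction "degree P" arbitrary: P)
  case 0
  then obtain c where "P = [:c:]"
    by (metis degree_eq_zeroE)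
  with 0 prime_idl_cst[OF Q] show ?case
    by auto
next
  case (Suc n)
  then have "\<not> constant (poly P)"
    by (simp add: constant_degree)
  then obtain r where "poly P r = 0"
    using fundamental_theorem_of_algebra by blast
  then obtain P' where P': "P = [:- r, 1:] * P'"
    by (auto simp: poly_eq_0_iff_dvd)
  with Suc.prems have "P' \<noteq> 0"
    by auto
  then have "degree P = Suc (degree P')"
    unfolding P' by (subst degree_mult_eq) auto
  have "upoly_ev x P = (x - cst r) * upoly_ev x P'"
    unfolding P' upoly_ev_mult by simp
  then have "x - cst r \<in> Q \<or> upoly_ev x P' \<in> Q"
    using Suc.prems Q x by (auto simp: prime_idl_def intro: Rm_intros upoly_ev_Rm)
  with \<open>degree P = _\<close> show ?case
    using Suc.hyps(1)[of P'] Suc.hyps(2) \<open>P' \<noteq> 0\<close> by auto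
qed

text \<open>Adding \<open>a\<close> to \<open>Q\<close> enlarges it, so a power of \<open>f\<close>
  enters. If \<open>a * b \<in> Q\<close> with neither factor in \<open>Q\<close>, multiplying the
  two relations would put a power of \<open>f\<close> into \<open>Q\<close>.\<close>

lemma maximal_avoiding_powers:
  assumes Q: "is_ideal m Q" and f: "f \<in> Rm m" and pow: "\<And>k. f ^ k \<notin> Q"
    and max: "\<forall>J. is_ideal m J \<and> Q \<subseteq> J \<and> (\<forall>k. f ^ k \<notin> J) \<longrightarrow> J = Q"
  shows maximal_avoiding_powersE:
      "\<And>a. a \<in> Rm m \<Longrightarrow> a \<notin> Q \<Longrightarrow> \<exists>k r. r \<in> Rm m \<and> f ^ k - r * a \<in> Q"
    and maximal_avoiding_powers_prime: "prime_idl m Q"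
proof -
  show E: "\<exists>k r. r \<in> Rm m \<and> f ^ k - r * a \<in> Q" if a: "a \<in> Rm m" "a \<notin> Q" for a
  proof -
    let ?J = "ideal_sum Q (ideal_times (Rm m) a)"
    note J = is_ideal_ideal_times[OF is_ideal_Rm a(1)]
    have "is_ideal m ?J" "Q \<subseteq> ?J" "?J \<noteq> Q"
      using is_ideal_ideal_sum[OF Q J] ideal_sum_superset[OF Q J] ideal_times_Rm_self[of a m] a(2)
      by auto
    then obtain k where "f ^ k \<in> ?J"
      using max by blast
    then obtain u r where "u \<in> Q" "r \<in> Rm m" "f ^ k = u + r * a"
      by (rule ideal_sum_timesE)
    then show ?thesis
      by (intro exI[of _ k] exI[of _ r]) simp
  qed
  have "a \<in> Q \<or> b \<in> Q" if ab: "a \<in> Rm m" "b \<in> Rm m" "a * b \<in> Q" for a b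
  proof (rule ccontr)
    assume "\<not> ?thesis"
    then obtain k r l s where r: "r \<in> Rm m" "f ^ k - r * a \<in> Q" and s: "s \<in> Rm m" "f ^ l - s * b \<in> Q"
      using E[OF ab(1)] E[OF ab(2)] by blast
    have "f ^ (k + l) = f ^ l * (f ^ k - r * a) + r * a * (f ^ l - s * b) + r * s * (a * b)"
      by (simp add: algebra_simps power_add)
    also have "\<dots> \<in> Q"
      using ideal_mult[OF Q _ r(2), of "f ^ l"] ideal_mult[OF Q _ s(2), of "r * a"]
        ideal_mult[OF Q _ ab(3), of "r * s"] r(1) s(1) ab(1) f
      by (intro ideal_add[OF Q]) (auto intro: Rm_intros)
    finally show False
      using pow by blast
  qed
  then show "prime_idl m Q"
    using Q pow[of 0] by (simp add: prime_idl_def)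
qed

text \<open>The countable side of a pigeonhole argument against the uncountable field.\<close>

lemma countable_monomial_sets: "countable {T :: (nat \<Rightarrow>\<^sub>0 nat) set. finite T}"
proof -
  have "inj_on (image goedel) {T. finite T}"
    by (rule inj_onI) (simp add: inj_image_eq_iff[OF inj_goedel])
  moreover have "countable (image goedel ` {T. finite T})"
    by (rule countable_subset[OF _ countable_Collect_finite]) auto
  ultimately show ?thesis
    by (simp add: countable_image_inj_eq)
qed

text \<open>If no \<open>x - c\<close> lay in \<open>Q\<close>, each would divide a power of \<open>f\<close> modulo \<open>Q\<close>. There are only
  countably many pairs of an exponent and a finite monomial support, so infinitely many of the
  cofactors share both; a linear relation between them is a polynomial equation for \<open>x\<close>
  modulo \<open>Q\<close>.\<close>
lemma avoiding_powers_coordinate: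
  assumes Q: "prime_idl m Q" and f: "f \<in> Rm m" "\<And>k. f ^ k \<notin> Q"
    and max: "\<And>a. a \<in> Rm m \<Longrightarrow> a \<notin> Q \<Longrightarrow> \<exists>k r. r \<in> Rm m \<and> f ^ k - r * a \<in> Q"
    and x: "x \<in> Rm m"
  shows "\<exists>c. x - cst c \<in> Q"
proof (rule ccontr)
  assume no: "\<nexists>c. x - cst c \<in> Q"
  have idl: "is_ideal m Q"
    using Q by (simp add: prime_idl_def)
  have "\<exists>k r. r \<in> Rm m \<and> f ^ k - r * (x - cst c) \<in> Q" for c
    using no x by (intro max) (auto intro: Rm_intros)
  then obtain k g where g: "\<And>c. g c \<in> Rm m" "\<And>c. f ^ k c - g c * (x - cst c) \<in> Q"
    by metis
  let ?F = "\<lambda>c::complex. (k c, keys (g c))"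
  have "countable (range ?F)"
    by (rule countable_subset[OF _ countable_SIGMA[OF countableI_type[of UNIV] countable_monomial_sets]]) auto
  have "\<exists>v\<in>range ?F. infinite (?F -` {v})"
  proof (rule ccontr)
    assume "\<not> ?thesis"
    then have "countable (\<Union>v\<in>range ?F. ?F -` {v})"
      using \<open>countable (range ?F)\<close> by (intro countable_UN) (auto intro: countable_finite)
    moreover have "(\<Union>v\<in>range ?F. ?F -` {v}) = UNIV"
      by auto
    ultimately show False
      using uncountable_UNIV_complex by simp
  qed
  then obtain K T where inf: "infinite {c. k c = K \<and> keys (g c) = T}"
    by (auto simp: vimage_def)
  define S where "S = {c. k c = K \<and> keys (g c) = T}"
  have "finite T"
    using inf not_finite_existsD[of "\<lambda>c. k c = K \<and> keys (g c) = T"] by auto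
  then obtain A a where A: "finite A" "A \<subseteq> S" "(\<Sum>c\<in>A. cst (a c) * g c) = 0"
      and "\<exists>c\<in>A. a c \<noteq> 0"
    using linear_dependence[of S T g] inf unfolding S_def by blast
  then obtain b where b: "b \<in> A" "a b \<noteq> 0"
    by blast
  \<comment> \<open>Modulo \<open>Q\<close>, \<open>g c\<close> behaves like
    \<open>f ^ K / (x - c)\<close>. \<open>P\<close> is the numerator of the sum of all
    \<open>a c / (x - c)\<close> over the common denominator; at \<open>b\<close> only the summand
    for \<open>b\<close> survives.\<close>
  define P where "P = (\<Sum>c\<in>A. smult (a c) (\<Prod>d\<in>A - {c}. [:- d, 1:]))"
  have "poly P b = (\<Sum>c\<in>A. a c * (\<Prod>d\<in>A - {c}. b - d))"
    by (simp add: P_def poly_sum poly_prod)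
  also have "\<dots> = a b * (\<Prod>d\<in>A - {b}. b - d)"
    using A(1) b(1) by (subst sum.remove[OF A(1) b(1)]) (auto intro!: sum.neutral)
  also have "\<dots> \<noteq> 0"
    using A(1) b by auto
  finally have "P \<noteq> 0"
    by auto
  have "f ^ K * upoly_ev x P = (\<Sum>c\<in>A. cst (a c) * (\<Prod>d\<in>A - {c}. x - cst d) * f ^ K)"
    by (simp add: P_def upoly_ev_sum upoly_ev_smult upoly_ev_prod sum_distrib_left mult_ac)
  \<comment> \<open>The factor \<open>x - cst c\<close> completes the product over
    \<open>A - {c}\<close> to the one over \<open>A\<close>, so the terms with \<open>g c\<close>
    add up to a multiple of the linear relation.\<close>
  also have "\<dots> = (\<Sum>c\<in>A. cst (a c) * (\<Prod>d\<in>A - {c}. x - cst d) * (f ^ K - g c * (x - cst c)))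
      + (\<Prod>d\<in>A. x - cst d) * (\<Sum>c\<in>A. cst (a c) * g c)"
    by (simp add: sum_distrib_left sum.distrib[symmetric] prod.remove[OF A(1)] algebra_simps
        cong: sum.cong)
  also have "\<dots> = (\<Sum>c\<in>A. cst (a c) * (\<Prod>d\<in>A - {c}. x - cst d) * (f ^ K - g c * (x - cst c)))"
    by (simp add: A(3))
  also have "\<dots> \<in> Q"
  proof (intro ideal_setsum[OF idl] ideal_mult[OF idl])
    fix c assume "c \<in> A"
    with A(2) have "k c = K"
      by (auto simp: S_def)
    then show "f ^ K - g c * (x - cst c) \<in> Q"
      using g(2)[of c] by simp
  qed (use x in \<open>auto intro: Rm_intros\<close>)
  finally have "upoly_ev x P \<in> Q"
    using Q f upoly_ev_Rm[OF x, of P] Rm_power[OF f(1), of K] by (auto simp: prime_idl_def)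
  with prime_idl_root[OF Q x \<open>P \<noteq> 0\<close>] no show False
    by blast
qed

text \<open>\<open>Q\<close> is maximal among the ideals that contain \<open>J\<close> and no power
  of \<open>f\<close>. Every variable is congruent to a constant modulo \<open>Q\<close>, and these
  constants are the coordinates of \<open>p\<close>. Each \<open>g\<close> in \<open>Rm m\<close> is
  then congruent to its value at \<open>p\<close>, so membership in \<open>Q\<close> means vanishing
  there.\<close>

lemma Nullstellensatz:
  assumes J: "is_ideal m J" and f: "f \<in> Rm m" "f \<notin> ideal_radical m J"
  shows "\<exists>p. (\<forall>g\<in>J. meval g p = 0) \<and> meval f p \<noteq> 0"
proof -
  let ?F = "{Q. is_ideal m Q \<and> J \<subseteq> Q \<and> (\<forall>k. f ^ k \<notin> Q)}"
  have "J \<in> ?F"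
    using J f by (auto simp: ideal_radical_def)
  then obtain Q where Q: "Q \<in> ?F" "\<forall>J\<in>?F. Q \<subseteq> J \<longrightarrow> J = Q"
    using maximal_ideal_exists[of ?F m J] by blast
  then have idl: "is_ideal m Q" and pow: "\<And>k. f ^ k \<notin> Q" and "J \<subseteq> Q"
    by auto
  have max: "\<forall>K. is_ideal m K \<and> Q \<subseteq> K \<and> (\<forall>k. f ^ k \<notin> K) \<longrightarrow> K = Q"
    using Q(2) \<open>J \<subseteq> Q\<close> by auto
  note prime = maximal_avoiding_powers_prime[OF idl f(1) pow max]
  have "\<exists>c. mvar j - cst c \<in> Q" if "j < m" for j
    by (rule avoiding_powers_coordinate[OF prime f(1) pow _ Rm_mvar[OF that]])
       (rule maximal_avoiding_powersE[OF idl f(1) pow max])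
  \<comment> \<open>Coordinates of index \<open>m\<close> or larger are left arbitrary; elements of
    \<open>Rm m\<close> do not involve them.\<close>
  then obtain p where p: "\<And>j. j < m \<Longrightarrow> mvar j - cst (p j) \<in> Q"
    by metis
  have eval: "g - cst (meval g p) \<in> Q" if "g \<in> Rm m" for g
    using that
  proof (induction rule: Rm_induct)
    case (cst c)
    then show ?case
      by (simp add: ideal_zero[OF idl])
  next
    case (add g h)
    then have "(g - cst (meval g p)) + (h - cst (meval h p)) \<in> Q"
      by (intro ideal_add[OF idl])
    then show ?case
      by (simp add: meval_simps algebra_simps)
  next
    case (mult g j)
    then have "(mvar j - cst (p j)) * g + cst (p j) * (g - cst (meval g p)) \<in> Q"
      by (intro ideal_add[OF idl] ideal_mult[OF idl] ideal_mult_right[OF idl] p) auto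
    then show ?case
      by (simp add: meval_simps algebra_simps)
  qed
  have "meval g p = 0" if "g \<in> J" for g
  proof -
    have g: "g \<in> Q"
      using that \<open>J \<subseteq> Q\<close> by (rule set_mp[rotated])
    then have "g - (g - cst (meval g p)) \<in> Q"
      by (rule ideal_diff[OF idl _ eval[OF ideal_subset[OF idl g]]])
    then show ?thesis
      using prime_idl_cst[OF prime] by simp
  qed
  moreover have "meval f p \<noteq> 0"
  proof
    assume "meval f p = 0"
    with eval[OF f(1)] pow[of 1] show False
      by simp
  qed
  ultimately show ?thesis
    by (intro exI[of _ p] conjI ballI)
qed

subsection \<open>The filtration by order of vanishing\<close>

definition mdeg :: "(nat \<Rightarrow>\<^sub>0 nat) \<Rightarrow> nat" where
  "mdeg \<mu> = (\<Sum>j\<in>keys \<mu>. lookup \<mu> j)"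

lemma mdeg_superset: "finite A \<Longrightarrow> keys \<mu> \<subseteq> A \<Longrightarrow> mdeg \<mu> = (\<Sum>j\<in>A. lookup \<mu> j)"
  unfolding mdeg_def by (rule sum.mono_neutral_left) (auto simp: in_keys_iff)

lemma mdeg_add: "mdeg (\<mu> + \<nu>) = mdeg \<mu> + mdeg \<nu>"
  using mdeg_superset[of "keys \<mu> \<union> keys \<nu>"] keys_add[of \<mu> \<nu>]
  by (simp add: lookup_add sum.distrib)

lemma mdeg_eq_0: "mdeg \<mu> = 0 \<longleftrightarrow> \<mu> = 0"
  by (auto simp: mdeg_def in_keys_iff) (metis poly_mapping_eqI lookup_zero gr0I)

lemma lookup_times_unique:
  fixes f g :: "'a::cancel_comm_monoid_add \<Rightarrow>\<^sub>0 'b::comm_ring"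
  assumes uniq: "\<And>\<mu> \<nu>. \<mu> \<in> keys f \<Longrightarrow> \<nu> \<in> keys g \<Longrightarrow> \<mu> + \<nu> = \<mu>0 + \<nu>0 \<Longrightarrow> \<mu> = \<mu>0"
  shows "lookup (f * g) (\<mu>0 + \<nu>0) = lookup f \<mu>0 * lookup g \<nu>0"
proof -
  define h where "h = f - single \<mu>0 (lookup f \<mu>0)"
  have keys_h: "keys h \<subseteq> keys f - {\<mu>0}"
    by (auto simp: h_def in_keys_iff lookup_minus lookup_single when_def split: if_splits)
  have "\<mu>0 + \<nu>0 \<notin> keys (h * g)"
    using keys_mult[of h g] keys_h uniq by fastforce
  moreover have "f * g = single \<mu>0 (lookup f \<mu>0) * g + h * g"
    by (simp add: h_def algebra_simps)
  ultimately show ?thesis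
    by (simp add: lookup_add lookup_single_mult in_keys_iff)
qed

lemma lowest_monomial:
  fixes f :: mpoly
  assumes "\<mu> \<in> keys f"
  obtains \<mu>0 where "\<mu>0 \<in> keys f" "mdeg \<mu>0 \<le> mdeg \<mu>"
    "\<And>\<nu>. \<nu> \<in> keys f \<Longrightarrow> mdeg \<mu>0 < mdeg \<nu> \<or> mdeg \<mu>0 = mdeg \<nu> \<and> goedel \<mu>0 \<le> goedel \<nu>"
proof -
  obtain \<mu>1 where 1: "\<mu>1 \<in> keys f" "\<And>\<nu>. \<nu> \<in> keys f \<Longrightarrow> mdeg \<mu>1 \<le> mdeg \<nu>"
    using ex_has_least_nat[of "\<lambda>\<nu>. \<nu> \<in> keys f" \<mu> mdeg] assms by blast
  obtain \<mu>0 where "\<mu>0 \<in> keys f \<and> mdeg \<mu>0 = mdeg \<mu>1"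
      "\<And>\<nu>. \<nu> \<in> keys f \<and> mdeg \<nu> = mdeg \<mu>1 \<Longrightarrow> goedel \<mu>0 \<le> goedel \<nu>"
    using ex_has_least_nat[of "\<lambda>\<nu>. \<nu> \<in> keys f \<and> mdeg \<nu> = mdeg \<mu>1" \<mu>1 goedel] 1(1) by blast
  with 1(2) assms show thesis
    by (intro that[of \<mu>0]) (metis, metis, metis le_neq_implies_less)
qed

text \<open>The least monomials, ordered by degree and then by Goedel number, multiply without
  cancellation.\<close>
lemma low_degree_mult:
  fixes f g :: mpoly
  assumes "\<mu> \<in> keys f" "\<nu> \<in> keys g"
  shows "\<exists>\<kappa>\<in>keys (f * g). mdeg \<kappa> \<le> mdeg \<mu> + mdeg \<nu>"
proof -
  obtain \<mu>0 where \<mu>0: "\<mu>0 \<in> keys f" "mdeg \<mu>0 \<le> mdeg \<mu>"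
    "\<And>\<nu>. \<nu> \<in> keys f \<Longrightarrow> mdeg \<mu>0 < mdeg \<nu> \<or> mdeg \<mu>0 = mdeg \<nu> \<and> goedel \<mu>0 \<le> goedel \<nu>"
    using lowest_monomial[OF assms(1)] by blast
  obtain \<nu>0 where \<nu>0: "\<nu>0 \<in> keys g" "mdeg \<nu>0 \<le> mdeg \<nu>"
    "\<And>\<nu>. \<nu> \<in> keys g \<Longrightarrow> mdeg \<nu>0 < mdeg \<nu> \<or> mdeg \<nu>0 = mdeg \<nu> \<and> goedel \<nu>0 \<le> goedel \<nu>"
    using lowest_monomial[OF assms(2)] by blast
  have "\<mu>' = \<mu>0" if *: "\<mu>' \<in> keys f" "\<nu>' \<in> keys g" "\<mu>' + \<nu>' = \<mu>0 + \<nu>0" for \<mu>' \<nu>'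
  proof -
    have d: "mdeg \<mu>' + mdeg \<nu>' = mdeg \<mu>0 + mdeg \<nu>0"
      and g: "goedel \<mu>' * goedel \<nu>' = goedel \<mu>0 * goedel \<nu>0"
      using *(3) by (metis mdeg_add, metis goedel_add)
    \<comment> \<open>Both degrees are minimal and their sums agree, so each agrees, and the Goedel
      comparison applies.\<close>
    have le: "goedel \<mu>0 \<le> goedel \<mu>'" "goedel \<nu>0 \<le> goedel \<nu>'"
      using \<mu>0(3)[OF *(1)] \<nu>0(3)[OF *(2)] d by auto
    have "goedel \<mu>' = goedel \<mu>0"
    proof (rule ccontr)
      assume "goedel \<mu>' \<noteq> goedel \<mu>0"
      with le have "goedel \<mu>0 * goedel \<nu>0 < goedel \<mu>' * goedel \<nu>'"
        by (intro mult_less_le_imp_less) (auto simp: goedel_pos)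
      with g show False by simp
    qed
    then show ?thesis
      using inj_goedel by (auto dest: injD)
  qed
  then have "lookup (f * g) (\<mu>0 + \<nu>0) = lookup f \<mu>0 * lookup g \<nu>0"
    by (rule lookup_times_unique)
  then have "\<mu>0 + \<nu>0 \<in> keys (f * g)"
    using \<mu>0(1) \<nu>0(1) by (simp add: in_keys_iff)
  with \<mu>0(2) \<nu>0(2) show ?thesis
    by (intro bexI[of _ "\<mu>0 + \<nu>0"]) (simp_all add: mdeg_add)
qed

section \<open>Powers of the maximal ideal at a point\<close>

definition shift :: "(nat \<Rightarrow> complex) \<Rightarrow> mpoly \<Rightarrow> mpoly" where
  "shift p = subst (\<lambda>j. mvar j + cst (p j))"

text \<open>The \<open>n\<close>-th power of the maximal ideal of \<open>p\<close>, described by the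
  Taylor expansion at \<open>p\<close> so that membership can be read off from degrees.\<close>

definition ord_ideal :: "nat \<Rightarrow> (nat \<Rightarrow> complex) \<Rightarrow> nat \<Rightarrow> mpoly set" where
  "ord_ideal m p n = {f \<in> Rm m. \<forall>\<mu>\<in>keys (shift p f). n \<le> mdeg \<mu>}"

lemma shift_Rm: "f \<in> Rm m \<Longrightarrow> shift p f \<in> Rm m"
  unfolding shift_def by (rule subst_Rm) (auto intro: Rm_intros)

lemma shift_inverse: "subst (\<lambda>j. mvar j - cst (p j)) (shift p f) = f"
  by (simp add: shift_def subst_subst subst_simps subst_mvar)

lemma ord_ideal_Rm: "f \<in> ord_ideal m p n \<Longrightarrow> f \<in> Rm m"
  by (simp add: ord_ideal_def)

lemma ord_ideal_0 [simp]: "ord_ideal m p 0 = Rm m"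
  by (auto simp: ord_ideal_def)

lemma ord_ideal_antimono: "a \<le> b \<Longrightarrow> ord_ideal m p b \<subseteq> ord_ideal m p a"
  by (auto simp: ord_ideal_def)

lemma ord_ideal_mult:
  assumes "f \<in> ord_ideal m p a" "g \<in> ord_ideal m p b"
  shows "f * g \<in> ord_ideal m p (a + b)"
  unfolding ord_ideal_def
proof (intro CollectI conjI ballI)
  fix \<kappa> assume "\<kappa> \<in> keys (shift p (f * g))"
  then obtain \<mu> \<nu> where "\<kappa> = \<mu> + \<nu>" "\<mu> \<in> keys (shift p f)" "\<nu> \<in> keys (shift p g)"
    using keys_mult[of "shift p f" "shift p g"] by (auto simp: shift_def subst_simps)
  with assms show "a + b \<le> mdeg \<kappa>"
    by (auto simp: ord_ideal_def mdeg_add intro: add_mono)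
qed (use assms in \<open>auto simp: ord_ideal_def intro: Rm_mult\<close>)

lemma is_ideal_ord_ideal: "is_ideal m (ord_ideal m p n)"
  unfolding is_ideal_def
proof (intro conjI ballI)
  fix f g assume fg: "f \<in> ord_ideal m p n" "g \<in> ord_ideal m p n"
  have "keys (shift p (f + g)) \<subseteq> keys (shift p f) \<union> keys (shift p g)"
    using keys_add by (simp add: shift_def subst_simps)
  with fg show "f + g \<in> ord_ideal m p n"
    by (auto simp: ord_ideal_def intro: Rm_add)
next
  fix r f assume "r \<in> Rm m" "f \<in> ord_ideal m p n"
  then show "r * f \<in> ord_ideal m p n"
    using ord_ideal_mult[of r m p 0 f n] by simp
qed (auto simp: ord_ideal_def shift_def subst_simps)

lemma ord_ideal_mult_notin:
  assumes "f \<in> Rm m" "f \<notin> ord_ideal m p (Suc a)" "g \<in> Rm m" "g \<notin> ord_ideal m p (Suc b)"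
  shows "f * g \<notin> ord_ideal m p (Suc (a + b))"
proof -
  obtain \<mu> \<nu> where "\<mu> \<in> keys (shift p f)" "mdeg \<mu> \<le> a" "\<nu> \<in> keys (shift p g)" "mdeg \<nu> \<le> b"
    using assms by (auto simp: ord_ideal_def not_less_eq_eq)
  moreover have "shift p (f * g) = shift p f * shift p g"
    by (simp add: shift_def subst_simps)
  ultimately show ?thesis
    using low_degree_mult[of \<mu> "shift p f" \<nu> "shift p g"] by (fastforce simp: ord_ideal_def)
qed

lemma meval_zero_point: "meval g (\<lambda>_. 0) = lookup g 0"
proof (induction g rule: mpoly_single_induct)
  case (add q \<mu> c)
  have "monom_ev (\<lambda>_. 0 :: complex) \<mu> = (if \<mu> = 0 then 1 else 0)"
    unfolding monom_ev_def by (auto simp: in_keys_iff) (metis poly_mapping_eqI lookup_zero gr0I)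
  with add show ?case
    by (simp add: meval_simps meval_single lookup_add lookup_single when_def)
qed (simp add: meval_simps)

lemma ord_ideal_1_iff: "f \<in> ord_ideal m p (Suc 0) \<longleftrightarrow> f \<in> Rm m \<and> meval f p = 0"
proof -
  have "meval f p = meval (shift p f) (\<lambda>_. 0)"
    by (simp add: shift_def meval_subst meval_simps)
  also have "\<dots> = lookup (shift p f) 0"
    by (rule meval_zero_point)
  finally have "meval f p = 0 \<longleftrightarrow> 0 \<notin> keys (shift p f)"
    by (simp add: in_keys_iff)
  also have "\<dots> \<longleftrightarrow> (\<forall>\<mu>\<in>keys (shift p f). Suc 0 \<le> mdeg \<mu>)"
    by (auto simp: Suc_le_eq mdeg_eq_0 simp flip: neq0_conv)
  finally show ?thesis
    by (simp add: ord_ideal_def)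
qed

text \<open>Pigeonhole: among \<open>m\<close> exponents of sum above \<open>m * l\<close> one is at
  least \<open>l\<close>. Hence every term of the Taylor expansion of \<open>f\<close> at
  \<open>p\<close> is a multiple of one of the given powers.\<close>

lemma ord_ideal_subset_of_powers:
  assumes K: "is_ideal m K" and pow: "\<And>j. j < m \<Longrightarrow> (mvar j - cst (p j)) ^ l \<in> K"
  shows "ord_ideal m p (Suc (m * l)) \<subseteq> K"
proof
  fix f assume f: "f \<in> ord_ideal m p (Suc (m * l))"
  let ?y = "\<lambda>j. mvar j - cst (p j)"
  have "f = (\<Sum>\<mu>\<in>keys (shift p f). cst (lookup (shift p f) \<mu>) * monom_ev ?y \<mu>)"
    using shift_inverse[of p f] by (simp add: subst_def peval_def)
  also have "\<dots> \<in> K"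
  proof (intro ideal_setsum[OF K] ideal_mult[OF K] Rm_cst)
    fix \<mu> assume \<mu>: "\<mu> \<in> keys (shift p f)"
    then have keys: "keys \<mu> \<subseteq> {..<m}"
      using Rm_keys[OF shift_Rm[OF ord_ideal_Rm[OF f]]] by blast
    have "\<exists>j<m. l \<le> lookup \<mu> j"
    proof (rule ccontr)
      assume "\<not> ?thesis"
      then have "(\<Sum>j<m. lookup \<mu> j) \<le> (\<Sum>j<m. l)"
        by (intro sum_mono) auto
      moreover have "Suc (m * l) \<le> mdeg \<mu>"
        using f \<mu> by (simp add: ord_ideal_def)
      ultimately show False
        using mdeg_superset[OF _ keys] by simp
    qed
    then obtain j where j: "j < m" "l \<le> lookup \<mu> j"
      by blast
    have "monom_ev ?y \<mu> = (\<Prod>i\<in>{..<m} - {j}. ?y i ^ lookup \<mu> i) * ?y j ^ lookup \<mu> j"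
      using j(1) by (simp add: monom_ev_superset[OF _ keys] prod.remove[of "{..<m}" j] mult.commute)
    also have "\<dots> \<in> K"
      using ideal_power_ge[OF K _ pow[OF j(1)] j(2)] j(1)
      by (intro ideal_mult[OF K]) (auto intro: Rm_intros)
    finally show "monom_ev ?y \<mu> \<in> K" .
  qed
  finally show "f \<in> K" .
qed

text \<open>The product case splits the difference as
  \<open>\<phi> j * (F - G) + (\<phi> j - \<psi> j) * G\<close>, with \<open>F\<close> and
  \<open>G\<close> the two images of the remaining factor.\<close>

lemma subst_diff_ord_ideal:
  assumes "f \<in> Rm m" and "\<And>j. j < m \<Longrightarrow> \<phi> j \<in> Rm m" "\<And>j. j < m \<Longrightarrow> \<psi> j \<in> Rm m"
    and diff: "\<And>j. j < m \<Longrightarrow> \<phi> j - \<psi> j \<in> ord_ideal m p n"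
  shows "subst \<phi> f - subst \<psi> f \<in> ord_ideal m p n"
  using assms(1)
proof (induction rule: Rm_induct)
  note idl = is_ideal_ord_ideal[of m p n]
  case (cst c)
  show ?case by (simp add: ideal_zero[OF idl])
next
  note idl = is_ideal_ord_ideal[of m p n]
  case (add f g)
  then have "(subst \<phi> f - subst \<psi> f) + (subst \<phi> g - subst \<psi> g) \<in> ord_ideal m p n"
    by (intro ideal_add[OF idl])
  then show ?case
    by (simp add: subst_simps algebra_simps)
next
  note idl = is_ideal_ord_ideal[of m p n]
  case (mult f j)
  have "\<phi> j * (subst \<phi> f - subst \<psi> f) + (\<phi> j - \<psi> j) * subst \<psi> f \<in> ord_ideal m p n"
    using mult assms
    by (intro ideal_add[OF idl] ideal_mult[OF idl _ mult.IH] ideal_mult_right[OF idl _ diff] subst_Rm)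
       auto
  then show ?case
    by (simp add: subst_simps algebra_simps)
qed

text \<open>An ideal \<open>K\<close> maximal among those containing \<open>I + \<mm> f\<close> but not \<open>f\<close>
  contains a power of \<open>\<mm>\<close>, because the chain \<open>K : y\<^sup>l\<close> stabilises for every \<open>y \<in> \<mm>\<close>.\<close>
lemma Krull_intersection:
  assumes I: "is_ideal m I" and f: "f \<in> Rm m"
    and inter: "\<And>n. f \<in> ideal_sum I (ord_ideal m p n)"
  shows "\<exists>s\<in>Rm m. meval s p \<noteq> 0 \<and> s * f \<in> I"
proof (rule ccontr)
  assume no: "\<not> ?thesis"
  let ?M = "ord_ideal m p (Suc 0)"
  have M: "is_ideal m ?M"
    by (rule is_ideal_ord_ideal)
  define L where "L = ideal_sum I (ideal_times ?M f)"
  note Mf = is_ideal_ideal_times[OF M f]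
  \<comment> \<open>Nakayama's argument: a relation \<open>f = u + q * f\<close> puts
    \<open>(1 - q) * f\<close> into \<open>I\<close>, while \<open>1 - q\<close> has value 1 at
    \<open>p\<close>.\<close>
  have "f \<notin> L"
  proof
    assume "f \<in> L"
    then obtain u q where u: "u \<in> I" and q: "q \<in> ?M" and f_eq: "f = u + q * f"
      unfolding L_def by (rule ideal_sum_timesE)
    have "(1 - q) * f = u"
      using f_eq by (metis add_diff_cancel_right' left_diff_distrib mult_1)
    with u q have "1 - q \<in> Rm m" "meval (1 - q) p \<noteq> 0" "(1 - q) * f \<in> I"
      by (simp_all add: ord_ideal_1_iff meval_simps Rm_diff)
    with no show False by blast
  qed
  let ?F = "{K. is_ideal m K \<and> L \<subseteq> K \<and> f \<notin> K}"
  have "L \<in> ?F"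
    using \<open>f \<notin> L\<close> is_ideal_ideal_sum[OF I Mf] by (simp add: L_def)
  then obtain K where K: "K \<in> ?F" "\<forall>K'\<in>?F. K \<subseteq> K' \<longrightarrow> K' = K"
    using maximal_ideal_exists[of ?F m L] by blast
  then have idl: "is_ideal m K" and "L \<subseteq> K" "f \<notin> K"
    by auto
  have "I \<subseteq> K" and Mf_K: "\<And>q. q \<in> ?M \<Longrightarrow> q * f \<in> K"
    using ideal_sum_superset[OF I Mf] \<open>L \<subseteq> K\<close> by (auto simp: L_def ideal_times_def)
  have max: "\<exists>u r. u \<in> K \<and> r \<in> Rm m \<and> f = u + r * a" if a: "a \<in> Rm m" "a \<notin> K" for a
  proof -
    note P = is_ideal_ideal_times[OF is_ideal_Rm a(1)]
    let ?K = "ideal_sum K (ideal_times (Rm m) a)"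
    have "is_ideal m ?K" "K \<subseteq> ?K" "?K \<noteq> K"
      using is_ideal_ideal_sum[OF idl P] ideal_sum_superset[OF idl P]
        ideal_times_Rm_self[of a m] a(2) by auto
    then have "f \<in> ?K"
      using K(2) \<open>L \<subseteq> K\<close> by blast
    then obtain u r where "u \<in> K" "r \<in> Rm m" "f = u + r * a"
      by (rule ideal_sum_timesE)
    then show ?thesis
      by (intro exI[of _ u] exI[of _ r] conjI)
  qed
  have "\<exists>l. (mvar j - cst (p j)) ^ l \<in> K" if "j < m" for j
  proof -
    define y where "y = mvar j - cst (p j)"
    have yM: "y \<in> ?M"
      using that by (simp add: y_def ord_ideal_1_iff meval_simps Rm_intros)
    note yR = ord_ideal_Rm[OF yM]
    define C where "C l = {r \<in> Rm m. y ^ l * r \<in> K}" for l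
    have "is_ideal m (C l)" for l
      unfolding is_ideal_def
    proof (intro conjI ballI)
      fix r a assume ra: "r \<in> Rm m" "a \<in> C l"
      have "r * (y ^ l * a) \<in> K"
        using ra by (intro ideal_mult[OF idl, of r]) (simp_all add: C_def)
      then have "y ^ l * (r * a) \<in> K"
        by (subst mult.left_commute)
      with ra show "r * a \<in> C l"
        by (simp add: C_def Rm_mult)
    qed (use ideal_zero[OF idl] in \<open>auto simp: C_def distrib_left Rm_add intro: ideal_add[OF idl]\<close>)
    moreover have "incseq C"
      by (rule incseq_SucI) (auto simp: C_def mult.assoc intro: ideal_mult[OF idl yR])
    ultimately obtain n where "\<forall>l\<ge>n. C l = C n"
      using ideal_chain_stabilises by blast
    then have stab: "C (Suc n) = C n"
      by (blast intro: le_SucI)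
    \<comment> \<open>Otherwise maximality gives \<open>f = u + r * y ^ n\<close>. Since
      \<open>y * f \<in> K\<close>, \<open>r\<close> lies in \<open>C (Suc n) = C n\<close>, and
      this forces \<open>f \<in> K\<close>.\<close>
    have "y ^ n \<in> K"
    proof (rule ccontr)
      assume "y ^ n \<notin> K"
      then obtain u r where u: "u \<in> K" and r: "r \<in> Rm m" and f_eq: "f = u + r * y ^ n"
        using max Rm_power[OF yR] by blast
      have "y ^ Suc n * r = y * f - y * u"
        by (simp add: f_eq algebra_simps)
      also have "\<dots> \<in> K"
        by (intro ideal_diff[OF idl] Mf_K yM ideal_mult[OF idl yR] u)
      finally have "r \<in> C (Suc n)"
        using r by (simp add: C_def)
      then have "y ^ n * r \<in> K"
        by (simp add: stab) (simp add: C_def)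
      then have "f \<in> K"
        using u ideal_add[OF idl] by (simp add: f_eq mult.commute)
      with \<open>f \<notin> K\<close> show False ..
    qed
    then show ?thesis
      unfolding y_def ..
  qed
  then obtain l where l: "\<And>j. j < m \<Longrightarrow> (mvar j - cst (p j)) ^ l j \<in> K"
    by metis
  define N where "N = (\<Sum>j<m. l j)"
  have "(mvar j - cst (p j)) ^ N \<in> K" if "j < m" for j
  proof (rule ideal_power_ge[OF idl _ l[OF that]])
    show "l j \<le> N"
      unfolding N_def using that by (intro member_le_sum) auto
  qed (use that in \<open>auto intro: Rm_intros\<close>)
  then have "ord_ideal m p (Suc (m * N)) \<subseteq> K"
    by (rule ord_ideal_subset_of_powers[OF idl])
  then have "f \<in> K"
    using inter[of "Suc (m * N)"] \<open>I \<subseteq> K\<close> ideal_add[OF idl] by (auto simp: ideal_sum_def)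
  with \<open>f \<notin> K\<close> show False ..
qed

subsection \<open>The local ring at a point where the differentials are independent\<close>

lemma mpderiv_superset:
  assumes "finite A" "keys p \<subseteq> A"
  shows "mpderiv j p = (\<Sum>\<mu>\<in>A. single (\<mu> - single j 1) (of_nat (lookup \<mu> j) * lookup p \<mu>))"
  unfolding mpderiv_def
  by (rule sum.mono_neutral_left) (use assms in \<open>auto simp: in_keys_iff\<close>)

lemma mpderiv_zero [simp]: "mpderiv j 0 = 0"
  by (simp add: mpderiv_def)

lemma mpderiv_add: "mpderiv j (p + q) = mpderiv j p + mpderiv j q"
proof -
  let ?A = "keys p \<union> keys q"
  have "keys (p + q) \<subseteq> ?A"
    by (rule keys_add)
  then show ?thesis
    by (simp add: mpderiv_superset[of ?A] lookup_add distrib_left single_add sum.distrib)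
qed

lemma mpderiv_single: "mpderiv j (single \<mu> c) = single (\<mu> - single j 1) (of_nat (lookup \<mu> j) * c)"
  by (cases "c = 0") (auto simp: mpderiv_def)

lemma mpderiv_cst [simp]: "mpderiv j (cst c) = 0"
  by (simp add: cst_def mpderiv_single)

lemma mpderiv_mvar_mult: "mpderiv i (mvar j * p) = (if i = j then p else 0) + mvar j * mpderiv i p"
proof (induction p rule: mpoly_single_induct)
  case (add p \<mu> c)
  have "mpderiv i (mvar j * single \<mu> c)
      = (if i = j then single \<mu> c else 0) + mvar j * mpderiv i (single \<mu> c)"
  proof (cases "i = j")
    case True
    \<comment> \<open>Exponents are subtracted with truncation, so a positive exponent is needed
      here; for exponent zero the derivative has coefficient zero.\<close>
    have "single j 1 + (\<mu> - single j 1) = \<mu>" if "lookup \<mu> j \<noteq> 0"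
      by (rule poly_mapping_eqI) (use that in \<open>auto simp: lookup_add lookup_minus lookup_single when_def\<close>)
    then show ?thesis
      using True
      by (cases "lookup \<mu> j = 0")
         (simp_all add: mvar_def mult_single mpderiv_single lookup_add distrib_right single_add
            del: One_nat_def)
  next
    case False
    have "single j 1 + \<mu> - single i 1 = single j 1 + (\<mu> - single i (1::nat))"
      by (rule poly_mapping_eqI) (use False in \<open>auto simp: lookup_add lookup_minus lookup_single when_def\<close>)
    with False show ?thesis
      by (simp add: mvar_def mult_single mpderiv_single lookup_add lookup_single_not_eq del: One_nat_def)
  qed
  with add show ?case
    by (simp add: distrib_left mpderiv_add)
qed simp

lemma mpderiv_Rm: "p \<in> Rm m \<Longrightarrow> mpderiv i p \<in> Rm m"
  by (induction rule: Rm_induct) (auto simp: mpderiv_add mpderiv_mvar_mult intro: Rm_intros)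

text \<open>First-order Taylor expansion with the remainder absorbed in the \<open>g a\<close>. In
  the product case \<open>mvar j * f\<close> is \<open>cst (p j) * f\<close> plus
  \<open>(mvar j - cst (p j)) * f\<close>, which adds \<open>f\<close> to the \<open>j\<close>-th
  coefficient.\<close>

lemma Hadamard:
  assumes "f \<in> Rm m"
  shows "\<exists>g. (\<forall>a<m. g a \<in> Rm m \<and> meval (g a) p = meval (mpderiv a f) p) \<and>
             f = cst (meval f p) + (\<Sum>a<m. (mvar a - cst (p a)) * g a)"
  using assms
proof (induction rule: Rm_induct)
  case (cst c)
  show ?case
    by (rule exI[of _ "\<lambda>_. 0"]) (simp add: meval_simps)
next
  case (add f1 f2)
  then obtain g1 g2 where g:
    "\<forall>a<m. g1 a \<in> Rm m \<and> meval (g1 a) p = meval (mpderiv a f1) p"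
    "\<forall>a<m. g2 a \<in> Rm m \<and> meval (g2 a) p = meval (mpderiv a f2) p"
    and f: "f1 = cst (meval f1 p) + (\<Sum>a<m. (mvar a - cst (p a)) * g1 a)"
    "f2 = cst (meval f2 p) + (\<Sum>a<m. (mvar a - cst (p a)) * g2 a)"
    by blast
  have "f1 + f2 = cst (meval (f1 + f2) p) + (\<Sum>a<m. (mvar a - cst (p a)) * (g1 a + g2 a))"
    by (subst (1) f(1), subst (1) f(2)) (simp add: meval_simps distrib_left sum.distrib)
  moreover have "\<forall>a<m. g1 a + g2 a \<in> Rm m \<and> meval (g1 a + g2 a) p = meval (mpderiv a (f1 + f2)) p"
    using g by (simp add: meval_simps mpderiv_add Rm_add)
  ultimately show ?case
    by (intro exI[of _ "\<lambda>a. g1 a + g2 a"] conjI)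
next
  case (mult f j)
  then obtain g where g: "\<forall>a<m. g a \<in> Rm m \<and> meval (g a) p = meval (mpderiv a f) p"
    and f: "f = cst (meval f p) + (\<Sum>a<m. (mvar a - cst (p a)) * g a)"
    by blast
  let ?g = "\<lambda>a. cst (p j) * g a + (if a = j then f else 0)"
  have split: "(mvar a - cst (p a)) * ?g a = (mvar a - cst (p a)) * (cst (p j) * g a)
      + (if a = j then (mvar a - cst (p a)) * f else 0)" for a
    by (simp add: distrib_left)
  have ev: "cst (meval (mvar j * f) p) = cst (p j) * cst (meval f p)"
    by (simp add: meval_simps)
  have "mvar j * f = cst (p j) * f + (mvar j - cst (p j)) * f"
    by (simp add: algebra_simps)
  also have "cst (p j) * f = cst (p j) * cst (meval f p) + (\<Sum>a<m. (mvar a - cst (p a)) * (cst (p j) * g a))"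
    by (subst f) (simp add: distrib_left sum_distrib_left mult_ac)
  also have "(mvar j - cst (p j)) * f = (\<Sum>a<m. if a = j then (mvar a - cst (p a)) * f else 0)"
    using mult.hyps(2) by simp
  finally have "mvar j * f = cst (meval (mvar j * f) p) + (\<Sum>a<m. (mvar a - cst (p a)) * ?g a)"
    unfolding split ev sum.distrib by (simp only: add.assoc)
  moreover have "\<forall>a<m. ?g a \<in> Rm m \<and> meval (?g a) p = meval (mpderiv a (mvar j * f)) p"
    using g mult.hyps by (simp add: meval_simps mpderiv_mvar_mult Rm_intros)
  ultimately show ?case
    by (intro exI[of _ ?g] conjI)
qed

lemma cst_sum: "cst (sum f A) = (\<Sum>a\<in>A. cst (f a))"
  by (induction A rule: infinite_finite_induct) simp_all

text \<open>The contraction to \<open>Rm m\<close> of the extension of \<open>I\<close> to the local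
  ring at \<open>p\<close>.\<close>

definition local_ideal :: "nat \<Rightarrow> (nat \<Rightarrow> complex) \<Rightarrow> mpoly set \<Rightarrow> mpoly set" where
  "local_ideal m p I = {f \<in> Rm m. \<exists>s\<in>Rm m. meval s p \<noteq> 0 \<and> s * f \<in> I}"

section \<open>The iterated substitution and its convergence\<close>

locale transversal =
  fixes m k :: nat and D :: "nat \<Rightarrow> mpoly" and p :: "nat \<Rightarrow> complex" and V :: "nat \<Rightarrow> nat \<Rightarrow> complex"
  assumes D_Rm: "i < k \<Longrightarrow> D i \<in> Rm m"
    and D_zero: "i < k \<Longrightarrow> meval (D i) p = 0"
    and dual: "i < k \<Longrightarrow> l < k \<Longrightarrow>
      (\<Sum>a<m. meval (mpderiv a (D i)) p * V l a) = (if i = l then 1 else 0)"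
begin

abbreviation "Fil \<equiv> ord_ideal m p"

text \<open>A Newton step towards the common zeros of the \<open>D l\<close>. As the
  \<open>V l\<close> are dual to the differentials, substituting it into \<open>D i\<close> cancels
  \<open>D i\<close> to first order at \<open>p\<close>.\<close>

definition move :: "nat \<Rightarrow> mpoly" where
  "move a = mvar a - (\<Sum>l<k. cst (V l a) * D l)"

definition it :: "nat \<Rightarrow> mpoly \<Rightarrow> mpoly" where
  "it n = subst move ^^ n"

lemma it_0 [simp]: "it 0 f = f"
  by (simp add: it_def)

lemma it_Suc: "it (Suc n) f = it n (subst move f)"
  by (simp add: it_def funpow_swap1)

lemma it_subst: "it n f = subst (\<lambda>a. it n (mvar a)) f"
proof (induction n)
  case (Suc n)
  have "it (Suc n) f = subst move (it n f)"
    by (simp add: it_def)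
  also have "it n f = subst (\<lambda>a. it n (mvar a)) f"
    by (rule Suc.IH)
  also have "subst move \<dots> = subst (\<lambda>a. it (Suc n) (mvar a)) f"
    by (simp add: subst_subst it_def)
  finally show ?case .
qed (simp add: subst_mvar)

lemma it_simps: "it n (f + g) = it n f + it n g" "it n (f - g) = it n f - it n g"
  "it n (f * g) = it n f * it n g" "it n (cst c) = cst c" "it n (sum h A) = (\<Sum>a\<in>A. it n (h a))"
  "it n (- f) = - it n f" "it n 0 = 0"
  by (induction n; simp add: it_def subst_simps)+

lemma move_Rm: "a < m \<Longrightarrow> move a \<in> Rm m"
  unfolding move_def by (auto intro!: Rm_intros D_Rm)

lemma it_Rm: "f \<in> Rm m \<Longrightarrow> it n f \<in> Rm m"
  by (induction n arbitrary: f) (auto simp: it_Suc intro: subst_Rm move_Rm)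

lemma meval_move: "meval (move a) p = p a"
  by (simp add: move_def meval_simps D_zero)

lemma meval_it: "meval (it n f) p = meval f p"
  by (induction n arbitrary: f) (simp_all add: it_Suc meval_subst meval_move)

lemma it_Fil_1: "f \<in> Fil (Suc 0) \<Longrightarrow> it n f \<in> Fil (Suc 0)"
  by (simp add: ord_ideal_1_iff it_Rm meval_it)

lemma it_diff_mvar: "it n (mvar a) - it (Suc n) (mvar a) = (\<Sum>l<k. cst (V l a) * it n (D l))"
  by (simp add: it_Suc subst_simps move_def it_simps)

text \<open>Write \<open>D i\<close> as its linear part \<open>L\<close> plus \<open>Q\<close>, the
  sum of the \<open>?y a * r a\<close>. By duality the substitution sends \<open>L\<close> to
  \<open>L - D i = - Q\<close>, so the image of \<open>D i\<close> is the image of \<open>Q\<close>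
  minus \<open>Q\<close>.\<close>

lemma subst_move_D:
  assumes "i < k"
  obtains r where "\<And>a. a < m \<Longrightarrow> r a \<in> Fil (Suc 0)"
    "subst move (D i) = (\<Sum>a<m. subst move (mvar a - cst (p a)) * subst move (r a))
       - (\<Sum>a<m. (mvar a - cst (p a)) * r a)"
proof -
  let ?y = "\<lambda>a. mvar a - cst (p a)"
  let ?d = "\<lambda>a. meval (mpderiv a (D i)) p"
  obtain g where g: "\<And>a. a < m \<Longrightarrow> g a \<in> Rm m \<and> meval (g a) p = ?d a"
    and "D i = cst (meval (D i) p) + (\<Sum>a<m. ?y a * g a)"
    using Hadamard[OF D_Rm[OF assms], of p] by blast
  then have D_eq: "D i = (\<Sum>a<m. ?y a * g a)"
    using D_zero[OF assms] by simp
  define r where "r a = g a - cst (?d a)" for a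
  have g_eq: "g a = cst (?d a) + r a" for a
    by (simp add: r_def)
  have r: "r a \<in> Fil (Suc 0)" if "a < m" for a
    using g[OF that] by (simp add: r_def ord_ideal_1_iff meval_simps Rm_intros)
  have D_eq': "D i = (\<Sum>a<m. cst (?d a) * ?y a) + (\<Sum>a<m. ?y a * r a)"
    by (subst D_eq) (simp add: g_eq distrib_left sum.distrib mult.commute)
  have "(\<Sum>a<m. cst (?d a) * subst move (?y a))
      = (\<Sum>a<m. cst (?d a) * ?y a) - (\<Sum>a<m. \<Sum>l<k. cst (?d a * V l a) * D l)"
    by (simp add: subst_simps move_def algebra_simps sum_distrib_left sum_subtractf sum.distrib)
  also have "(\<Sum>a<m. \<Sum>l<k. cst (?d a * V l a) * D l) = (\<Sum>l<k. cst (\<Sum>a<m. ?d a * V l a) * D l)"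
    by (subst sum.swap) (simp only: cst_sum sum_distrib_right)
  also have "\<dots> = (\<Sum>l<k. if i = l then D l else 0)"
    by (rule sum.cong) (auto simp: dual assms)
  also have "\<dots> = D i"
    using assms by simp
  finally have X: "(\<Sum>a<m. cst (?d a) * subst move (?y a)) = (\<Sum>a<m. cst (?d a) * ?y a) - D i" .
  have "x = y - d \<Longrightarrow> d = y + z \<Longrightarrow> x = - z" for x y z d :: mpoly
    by simp
  from this[OF X D_eq']
  have "(\<Sum>a<m. cst (?d a) * subst move (?y a)) = - (\<Sum>a<m. ?y a * r a)" .
  moreover have "subst move (D i)
      = (\<Sum>a<m. cst (?d a) * subst move (?y a)) + (\<Sum>a<m. subst move (?y a) * subst move (r a))"
    by (subst D_eq') (simp add: subst_simps)
  ultimately show thesis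
    using that[of r] r by simp
qed

text \<open>By \<open>subst_move_D\<close>, \<open>it (Suc n) (D i)\<close> is the difference of two
  consecutive iterates of a sum of products of elements of order at least 1. By induction
  consecutive iterates of any polynomial differ by order at least \<open>n + 1\<close>; the other
  factor supplies one more.\<close>

lemma it_D: "i < k \<Longrightarrow> it n (D i) \<in> Fil (Suc n)"
proof (induction n arbitrary: i)
  case 0
  then show ?case
    by (simp add: ord_ideal_1_iff D_Rm D_zero)
next
  case (Suc n)
  let ?y = "\<lambda>a. mvar a - cst (p a)"
  obtain r where r: "\<And>a. a < m \<Longrightarrow> r a \<in> Fil (Suc 0)"
    and eq: "subst move (D i) = (\<Sum>a<m. subst move (?y a) * subst move (r a)) - (\<Sum>a<m. ?y a * r a)"
    using subst_move_D[OF Suc.prems] by blast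
  note idl = is_ideal_ord_ideal[of m p]
  have diff_mvar: "it (Suc n) (mvar a) - it n (mvar a) \<in> Fil (Suc n)" for a
  proof -
    have "- (it n (mvar a) - it (Suc n) (mvar a)) \<in> Fil (Suc n)"
      unfolding it_diff_mvar
      by (intro ideal_uminus[OF idl] ideal_setsum[OF idl] ideal_mult[OF idl] Suc.IH) auto
    then show ?thesis by simp
  qed
  have diff: "it (Suc n) f - it n f \<in> Fil (Suc n)" if "f \<in> Rm m" for f
    by (subst (1 2) it_subst)
       (intro subst_diff_ord_ideal that diff_mvar it_Rm Rm_mvar; assumption)
  have "it n ((\<Sum>a<m. subst move (y a) * subst move (r a)) - (\<Sum>a<m. y a * r a))
      = (\<Sum>a<m. it (Suc n) (y a) * it (Suc n) (r a) - it n (y a) * it n (r a))" for y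
    by (simp add: it_Suc it_simps sum_subtractf)
  from this[of ?y]
  have "it (Suc n) (D i) = (\<Sum>a<m. it (Suc n) (?y a) * it (Suc n) (r a) - it n (?y a) * it n (r a))"
    by (simp only: it_Suc[of n "D i"] eq)
  also have "\<dots> \<in> Fil (Suc (Suc n))"
  proof (rule ideal_setsum[OF idl])
    fix a assume "a \<in> {..<m}"
    then have a: "a < m" by simp
    have y: "?y a \<in> Fil (Suc 0)"
      using a by (simp add: ord_ideal_1_iff meval_simps Rm_intros)
    have "it (Suc n) (?y a) * (it (Suc n) (r a) - it n (r a)) \<in> Fil (Suc 0 + Suc n)"
      using r[OF a] by (intro ord_ideal_mult it_Fil_1 y diff) (rule ord_ideal_Rm)
    moreover have "(it (Suc n) (?y a) - it n (?y a)) * it n (r a) \<in> Fil (Suc n + Suc 0)"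
      using r[OF a] y by (intro ord_ideal_mult it_Fil_1 diff) (rule ord_ideal_Rm)
    ultimately have "it (Suc n) (?y a) * (it (Suc n) (r a) - it n (r a))
        + (it (Suc n) (?y a) - it n (?y a)) * it n (r a) \<in> Fil (Suc (Suc n))"
      by (intro ideal_add[OF idl]) simp_all
    then show "it (Suc n) (?y a) * it (Suc n) (r a) - it n (?y a) * it n (r a) \<in> Fil (Suc (Suc n))"
      by (simp add: algebra_simps)
  qed
  finally show ?case .
qed

text \<open>Consecutive iterates of a variable differ by combinations of the
  \<open>it N (D l)\<close>, whose order grows by \<open>it_D\<close>; the differences telescope.
  The iterates are thus a Cauchy sequence for the filtration.\<close>

lemma it_diff:
  assumes f: "f \<in> Rm m" and le: "n \<le> N"
  shows "it N f - it n f \<in> Fil (Suc n)"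
  using le
proof (induction N rule: dec_induct)
  case base
  show ?case
    by (simp add: ideal_zero[OF is_ideal_ord_ideal])
next
  case (step N)
  note idl = is_ideal_ord_ideal[of m p]
  have "it (Suc N) (mvar a) - it N (mvar a) \<in> Fil (Suc N)" for a
  proof -
    have "- (it N (mvar a) - it (Suc N) (mvar a)) \<in> Fil (Suc N)"
      unfolding it_diff_mvar
      by (intro ideal_uminus[OF idl] ideal_setsum[OF idl] ideal_mult[OF idl] it_D) auto
    then show ?thesis by simp
  qed
  then have "it (Suc N) f - it N f \<in> Fil (Suc N)"
    by (subst (1 2) it_subst) (intro subst_diff_ord_ideal f it_Rm Rm_mvar; assumption)
  then have "it (Suc N) f - it N f \<in> Fil (Suc n)"
    using ord_ideal_antimono[of "Suc n" "Suc N"] step.hyps by auto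
  from ideal_add[OF idl this step.IH] show ?case
    by simp
qed

context
  fixes I
  assumes I: "I = ideal_gen m (D ` {..<k})"
begin

lemma I_ideal: "is_ideal m I"
  unfolding I by (rule is_ideal_ideal_gen) (auto intro: D_Rm)

text \<open>Each variable moves only by a combination of the \<open>D l\<close>, so the substitution
  is the identity modulo \<open>I\<close>.\<close>

lemma diff_it_in_I:
  assumes "f \<in> Rm m"
  shows "f - it n f \<in> I"
  using assms
proof (induction n arbitrary: f)
  case 0
  show ?case by (simp add: ideal_zero[OF I_ideal])
next
  case (Suc n)
  have "f - subst move f \<in> I"
    using Suc.prems
  proof (induction rule: Rm_induct)
    case (cst c)
    show ?case by (simp add: ideal_zero[OF I_ideal])
  next
    case (add f g)
    then have "(f - subst move f) + (g - subst move g) \<in> I"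
      by (intro ideal_add[OF I_ideal])
    then show ?case by (simp add: subst_simps algebra_simps)
  next
    case (mult f j)
    have "D l \<in> I" if "l < k" for l
      using that ideal_gen_superset[of "D ` {..<k}" m] I by auto
    then have "mvar j - move j \<in> I"
      by (auto simp: move_def intro!: ideal_setsum[OF I_ideal] ideal_mult[OF I_ideal])
    then have "(mvar j - move j) * f + move j * (f - subst move f) \<in> I"
      using mult
      by (intro ideal_add[OF I_ideal] ideal_mult[OF I_ideal _ mult.IH] ideal_mult_right[OF I_ideal] move_Rm)
    then show ?case by (simp add: subst_simps algebra_simps)
  qed
  moreover have "subst move f - it n (subst move f) \<in> I"
    using Suc.prems by (intro Suc.IH subst_Rm move_Rm)
  ultimately have "(f - subst move f) + (subst move f - it n (subst move f)) \<in> I"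
    by (rule ideal_add[OF I_ideal])
  then show ?case
    by (simp add: it_Suc)
qed

text \<open>The polynomials satisfying the right-hand side form an ideal containing the generators
  of \<open>I\<close>; a factor \<open>s\<close> with nonzero value keeps order 0 under iteration
  and can be cancelled. Conversely \<open>f = (f - it n f) + it n f\<close> lies in
  \<open>I + Fil n\<close> for every \<open>n\<close>, and Krull's theorem applies.\<close>

lemma local_ideal_iff:
  assumes f: "f \<in> Rm m"
  shows "f \<in> local_ideal m p I \<longleftrightarrow> (\<forall>n. it n f \<in> Fil (Suc n))"
proof
  note idl = is_ideal_ord_ideal[of m p]
  let ?K = "{f \<in> Rm m. \<forall>n. it n f \<in> Fil (Suc n)}"
  have "is_ideal m ?K"
    unfolding is_ideal_def
  proof (intro conjI ballI)
    fix r f assume "r \<in> Rm m" "f \<in> ?K"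
    then show "r * f \<in> ?K"
      using ideal_mult[OF idl it_Rm] by (simp add: it_simps Rm_mult)
  qed (auto simp: it_simps ideal_zero[OF idl] Rm_add intro: ideal_add[OF idl])
  then have "I \<subseteq> ?K"
    unfolding I by (rule ideal_gen_least) (auto intro: it_D D_Rm)
  assume "f \<in> local_ideal m p I"
  then obtain s where s: "s \<in> Rm m" "meval s p \<noteq> 0" "s * f \<in> ?K"
    using \<open>I \<subseteq> ?K\<close> by (auto simp: local_ideal_def)
  show "\<forall>n. it n f \<in> Fil (Suc n)"
  proof (intro allI, rule ccontr)
    fix n assume "it n f \<notin> Fil (Suc n)"
    moreover have "it n s \<notin> Fil (Suc 0)"
      using s(2) by (simp add: ord_ideal_1_iff meval_it)
    ultimately have "it n s * it n f \<notin> Fil (Suc (0 + n))"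
      using s(1) f by (intro ord_ideal_mult_notin it_Rm)
    with s(3) show False
      by (simp add: it_simps)
  qed
next
  assume *: "\<forall>n. it n f \<in> Fil (Suc n)"
  have "f \<in> ideal_sum I (Fil n)" for n
  proof -
    have "f = (f - it n f) + it n f"
      by simp
    moreover have "it n f \<in> Fil n"
      using * ord_ideal_antimono[of n "Suc n"] by auto
    ultimately show ?thesis
      unfolding ideal_sum_def using diff_it_in_I[OF f, of n] by blast
  qed
  then show "f \<in> local_ideal m p I"
    using Krull_intersection[OF I_ideal f] f by (simp add: local_ideal_def)
qed

text \<open>If \<open>it a f\<close> has order at most \<open>a\<close>, so has every later iterate,
  since the difference has larger order. At the common index \<open>a + b\<close> the orders of the
  two factors add up to at most \<open>a + b\<close>.\<close>

lemma local_ideal_mult: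
  assumes f: "f \<in> Rm m" "f \<notin> local_ideal m p I" and g: "g \<in> Rm m" "g \<notin> local_ideal m p I"
  shows "f * g \<notin> local_ideal m p I"
proof -
  have stable: "it N f \<notin> Fil (Suc n)" if "f \<in> Rm m" "it n f \<notin> Fil (Suc n)" "n \<le> N" for f n N
  proof
    assume "it N f \<in> Fil (Suc n)"
    then have "it N f - (it N f - it n f) \<in> Fil (Suc n)"
      by (intro ideal_diff[OF is_ideal_ord_ideal] it_diff that)
    with that(2) show False by simp
  qed
  obtain a b where ab: "it a f \<notin> Fil (Suc a)" "it b g \<notin> Fil (Suc b)"
    using f g local_ideal_iff by blast
  have "it (a + b) f * it (a + b) g \<notin> Fil (Suc (a + b))"
    using stable[OF f(1) ab(1), of "a + b"] stable[OF g(1) ab(2), of "a + b"] f(1) g(1)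
    by (intro ord_ideal_mult_notin it_Rm) simp_all
  then show ?thesis
    using f g by (auto simp: local_ideal_iff Rm_mult it_simps)
qed

end

end

subsection \<open>Exterior products with covectors\<close>

text \<open>The wedge product at a fixed point with the covector \<open>d\<close> on the right; the
  sign counts the factors that the one with index \<open>b\<close> must pass to reach its
  place.\<close>

definition cwedge :: "(nat set \<Rightarrow> complex) \<Rightarrow> (nat \<Rightarrow> complex) \<Rightarrow> nat set \<Rightarrow> complex" where
  "cwedge \<eta> d K = (\<Sum>b\<in>K. (-1) ^ card {a \<in> K. b < a} * \<eta> (K - {b}) * d b)"

definition grad :: "nat \<Rightarrow> (nat \<Rightarrow> complex) \<Rightarrow> mpoly \<Rightarrow> nat \<Rightarrow> complex" where
  "grad m p D j = (if j < m then meval (mpderiv j D) p else 0)"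

text \<open>\<open>dpoly\<close> vanishes off singletons, so only subsets \<open>A\<close> with a
  one-element complement contribute. For infinite \<open>K\<close> both sums are 0.\<close>

lemma wedge_dpoly:
  "wedge \<eta> (dpoly m D) K
     = (\<Sum>b\<in>K. (-1) ^ card {a \<in> K. b < a} * \<eta> (K - {b}) * (if b < m then mpderiv b D else 0))"
proof (cases "finite K")
  case True
  let ?t = "\<lambda>A. (- 1) ^ card {(a, b). a \<in> A \<and> b \<in> K - A \<and> b < a} * \<eta> A * dpoly m D (K - A)"
  have inj: "inj_on (\<lambda>b. K - {b}) K"
    by (auto simp: inj_on_def)
  have "wedge \<eta> (dpoly m D) K = (\<Sum>A\<in>(\<lambda>b. K - {b}) ` K. ?t A)"
    unfolding wedge_def
  proof (rule sum.mono_neutral_right)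
    show "\<forall>A\<in>Pow K - (\<lambda>b. K - {b}) ` K. ?t A = 0"
    proof
      fix A assume A: "A \<in> Pow K - (\<lambda>b. K - {b}) ` K"
      have "K - A \<noteq> {j}" for j
      proof
        assume "K - A = {j}"
        with A have "A = K - {j}" "j \<in> K"
          by auto
        with A show False by blast
      qed
      then show "?t A = 0"
        by (auto simp: dpoly_def)
    qed
  qed (use True in auto)
  also have "\<dots> = (\<Sum>b\<in>K. ?t (K - {b}))"
    by (simp add: sum.reindex[OF inj])
  also have "\<dots> = (\<Sum>b\<in>K. (-1) ^ card {a \<in> K. b < a} * \<eta> (K - {b}) * (if b < m then mpderiv b D else 0))"
  proof (rule sum.cong)
    fix b assume "b \<in> K"
    then have K: "K - (K - {b}) = {b}"
      by auto
    have "{(a, c). a \<in> K - {b} \<and> c \<in> {b} \<and> c < a} = (\<lambda>a. (a, b)) ` {a \<in> K. b < a}"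
      by auto
    then have "card {(a, c). a \<in> K - {b} \<and> c \<in> {b} \<and> c < a} = card {a \<in> K. b < a}"
      by (simp add: card_image inj_on_def)
    then show "?t (K - {b}) = (-1) ^ card {a \<in> K. b < a} * \<eta> (K - {b}) * (if b < m then mpderiv b D else 0)"
      unfolding K by (simp add: dpoly_def)
  qed simp
  finally show ?thesis .
qed (simp add: wedge_def)

lemma meval_wedge: "meval (wedge \<eta> (dpoly m D) K) p = cwedge (\<lambda>A. meval (\<eta> A) p) (grad m p D) K"
  unfolding wedge_dpoly cwedge_def grad_def
  by (simp add: meval_simps if_distrib[of "\<lambda>q. meval q p"] cong: if_cong)

lemma meval_wedge_dD:
  "meval (wedge_dD m \<alpha> Ds K) p = foldl cwedge (\<lambda>A. meval (\<alpha> A) p) (map (grad m p) Ds) K"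
  by (induction Ds arbitrary: K rule: rev_induct) (simp_all add: wedge_dD_def meval_wedge)

text \<open>Removing the smaller index keeps the count above \<open>c\<close>, while removing the
  larger one lowers the count above \<open>b\<close> by one.\<close>

lemma cwedge_sign_swap:
  fixes K :: "nat set"
  assumes "finite K" "b \<in> K" "c \<in> K" "b < c"
  shows "(-1::complex) ^ card {a \<in> K. b < a} * (-1) ^ card {a \<in> K - {b}. c < a}
       = - ((-1) ^ card {a \<in> K. c < a} * (-1) ^ card {a \<in> K - {c}. b < a})"
proof -
  have "{a \<in> K - {b}. c < a} = {a \<in> K. c < a}"
    using assms by auto
  moreover have "{a \<in> K. b < a} = insert c {a \<in> K - {c}. b < a}"
    using assms by auto
  then have "card {a \<in> K. b < a} = Suc (card {a \<in> K - {c}. b < a})"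
    using assms by simp
  ultimately show ?thesis
    by simp
qed

lemma cwedge_anticommute: "cwedge (cwedge \<eta> d) e K = - cwedge (cwedge \<eta> e) d K"
proof (cases "finite K")
  case True
  define s where "s b c = (-1::complex) ^ card {a \<in> K. b < a} * (-1) ^ card {a \<in> K - {b}. c < a}" for b c
  have swap: "s b c = - s c b" if "b \<in> K" "c \<in> K" "b \<noteq> c" for b c
    using cwedge_sign_swap[OF True, of b c] cwedge_sign_swap[OF True, of c b] that
    unfolding s_def by (cases "b < c") auto
  have expand: "cwedge (cwedge \<eta> d) e K
      = (\<Sum>b\<in>K. \<Sum>c\<in>K. if b = c then 0 else s b c * \<eta> (K - {b} - {c}) * d c * e b)" for d e
  proof -
    have "cwedge (cwedge \<eta> d) e K
      = (\<Sum>b\<in>K. \<Sum>c\<in>K - {b}. s b c * \<eta> (K - {b} - {c}) * d c * e b)"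
      by (simp add: cwedge_def s_def sum_distrib_left sum_distrib_right mult_ac)
    also have "\<dots> = (\<Sum>b\<in>K. \<Sum>c\<in>K. if b = c then 0 else s b c * \<eta> (K - {b} - {c}) * d c * e b)"
      by (intro sum.cong sum.mono_neutral_cong_left) (use True in auto)
    finally show ?thesis .
  qed
  have "cwedge (cwedge \<eta> d) e K
      = (\<Sum>c\<in>K. \<Sum>b\<in>K. if b = c then 0 else s b c * \<eta> (K - {b} - {c}) * d c * e b)"
    unfolding expand by (rule sum.swap)
  also have "\<dots> = (\<Sum>c\<in>K. \<Sum>b\<in>K. - (if c = b then 0 else s c b * \<eta> (K - {c} - {b}) * e b * d c))"
  proof (intro sum.cong refl)
    fix b c assume bc: "c \<in> K" "b \<in> K"
    have "K - {b} - {c} = K - {c} - {b}"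
      by auto
    then show "(if b = c then 0 else s b c * \<eta> (K - {b} - {c}) * d c * e b)
        = - (if c = b then 0 else s c b * \<eta> (K - {c} - {b}) * e b * d c)"
      using swap[OF bc(2,1)] by simp
  qed
  also have "\<dots> = - cwedge (cwedge \<eta> e) d K"
    by (simp add: expand[of e d] sum_negf del: sum.swap)
  finally show ?thesis .
qed (simp add: cwedge_def)

text \<open>\<open>d\<close> is moved past the later factors until it meets its copy, where the
  product equals its own negative.\<close>

lemma foldl_cwedge_member:
  assumes "d \<in> set ds"
  shows "cwedge (foldl cwedge \<eta> ds) d K = 0"
  using assms
proof (induction ds arbitrary: K rule: rev_induct)
  case (snoc e ds)
  let ?\<eta> = "foldl cwedge \<eta> ds"
  show ?case
  proof (cases "d = e")
    case True
    then show ?thesis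
      using cwedge_anticommute[of ?\<eta> d d K] by simp
  next
    case False
    then have "cwedge ?\<eta> d = (\<lambda>_. 0)"
      using snoc by auto
    moreover have "cwedge (\<lambda>_. 0) e K = 0"
      by (simp add: cwedge_def)
    ultimately show ?thesis
      using cwedge_anticommute[of ?\<eta> e d K] by simp
  qed
qed simp

lemma cwedge_diff_sum:
  "cwedge \<eta> (\<lambda>a. d a - (\<Sum>l\<in>A. c l * x l a)) K = cwedge \<eta> d K - (\<Sum>l\<in>A. c l * cwedge \<eta> (x l) K)"
proof -
  have "(\<Sum>l\<in>A. c l * cwedge \<eta> (x l) K)
      = (\<Sum>b\<in>K. \<Sum>l\<in>A. (-1) ^ card {a \<in> K. b < a} * \<eta> (K - {b}) * (c l * x l b))"
    by (subst sum.swap) (simp add: cwedge_def sum_distrib_left mult_ac)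
  then show ?thesis
    by (simp add: cwedge_def right_diff_distrib sum_subtractf sum_distrib_left)
qed

text \<open>A nonzero product forces independence, and dual vectors are built as in Gram-Schmidt.
  Subtracting from \<open>d\<close> a combination of the earlier covectors does not change the
  product, so the remainder \<open>d'\<close> is nonzero at some index \<open>a\<close>.\<close>

lemma dual_vectors:
  assumes "foldl cwedge \<eta> ds K \<noteq> 0" and "\<And>d j. d \<in> set ds \<Longrightarrow> m \<le> j \<Longrightarrow> d j = 0"
  shows "\<exists>V. \<forall>i<length ds. \<forall>l<length ds. (\<Sum>a<m. (ds ! i) a * V l a) = (if i = l then 1 else 0 :: complex)"
  using assms
proof (induction ds arbitrary: K rule: rev_induct)
  case (snoc d ds)
  let ?\<eta> = "foldl cwedge \<eta> ds" and ?k = "length ds"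
  let ?pair = "\<lambda>x v. \<Sum>a<m. x a * v a :: complex"
  have ne: "cwedge ?\<eta> d K \<noteq> 0"
    using snoc.prems(1) by simp
  then obtain b where "?\<eta> (K - {b}) \<noteq> 0"
    by (force simp: cwedge_def intro: ccontr sum.neutral)
  then obtain V where "\<forall>i<?k. \<forall>l<?k. ?pair (ds ! i) (V l) = (if i = l then 1 else 0)"
    using snoc.IH[of "K - {b}"] snoc.prems(2) by auto
  then have V: "?pair (ds ! i) (V l) = (if i = l then 1 else 0)" if "i < ?k" "l < ?k" for i l
    using that by blast
  define d' where "d' a = d a - (\<Sum>l<?k. ?pair d (V l) * (ds ! l) a)" for a
  have "cwedge ?\<eta> d' K = cwedge ?\<eta> d K"
    unfolding d'_def[abs_def] cwedge_diff_sum
    by (simp add: foldl_cwedge_member)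
  then obtain a where a: "d' a \<noteq> 0"
    using ne by (force simp: cwedge_def intro: ccontr sum.neutral)
  have "a < m"
  proof (rule ccontr)
    assume "\<not> a < m"
    then have "d a = 0" "\<And>l. l < ?k \<Longrightarrow> (ds ! l) a = 0"
      using snoc.prems(2)[of _ a] by simp_all
    with a show False
      by (simp add: d'_def)
  qed
  \<comment> \<open>The unit vector of index \<open>a\<close> minus its components along the
    \<open>V l\<close>: the earlier covectors vanish on it and \<open>d\<close> takes the value
    \<open>d' a\<close>.\<close>
  define w where "w j = (if j = a then 1 else 0) - (\<Sum>l<?k. (ds ! l) a * V l j)" for j
  have pair_w: "?pair x w = x a - (\<Sum>l<?k. (ds ! l) a * ?pair x (V l))" for x
  proof -
    have "x j * w j = (if j = a then x j else 0) - (\<Sum>l<?k. (ds ! l) a * (x j * V l j))" for j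
      by (cases "j = a") (simp_all add: w_def right_diff_distrib sum_distrib_left mult_ac)
    then have "?pair x w = (\<Sum>j<m. if j = a then x j else 0) - (\<Sum>j<m. \<Sum>l<?k. (ds ! l) a * (x j * V l j))"
      by (simp only: sum_subtractf)
    also have "(\<Sum>j<m. \<Sum>l<?k. (ds ! l) a * (x j * V l j)) = (\<Sum>l<?k. (ds ! l) a * ?pair x (V l))"
      by (subst sum.swap) (simp add: sum_distrib_left)
    finally show ?thesis
      using \<open>a < m\<close> by simp
  qed
  have w_ds: "?pair (ds ! i) w = 0" if "i < ?k" for i
  proof -
    have "(\<Sum>l<?k. (ds ! l) a * ?pair (ds ! i) (V l)) = (\<Sum>l<?k. if i = l then (ds ! l) a else 0)"
      by (rule sum.cong) (auto simp: V that)
    with that show ?thesis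
      by (simp add: pair_w)
  qed
  have w_d: "?pair d w = d' a"
    by (simp add: pair_w d'_def mult.commute)
  \<comment> \<open>\<open>w / d' a\<close> becomes the new dual vector, and each old
    \<open>V l\<close> is corrected by a multiple of it so that \<open>d\<close> vanishes
    there.\<close>
  define V' where "V' l j = (if l < ?k then V l j - ?pair d (V l) * (w j / d' a) else w j / d' a)" for l j
  have pair_V': "?pair x (V' l) = (if l < ?k then ?pair x (V l) - ?pair d (V l) * (?pair x w / d' a)
      else ?pair x w / d' a)" for x l
    by (simp add: V'_def right_diff_distrib sum_subtractf sum_distrib_left sum_divide_distrib mult_ac)
  have "?pair ((ds @ [d]) ! i) (V' l) = (if i = l then 1 else 0)" if "i < Suc ?k" "l < Suc ?k" for i l
    using that a by (auto simp: pair_V' w_ds w_d V nth_append less_Suc_eq)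
  then show ?case
    by (intro exI[of _ V']) simp
qed simp

section \<open>Ranks of the wedge products\<close>

lemma is_form_wedge_dpoly:
  assumes \<eta>: "is_form m r \<eta>" and D: "D \<in> Rm m"
  shows "is_form m (r + 1) (wedge \<eta> (dpoly m D))"
  unfolding is_form_def
proof (intro conjI allI impI)
  fix K
  have "\<eta> A \<in> Rm m" for A
    using \<eta> by (simp add: is_form_def)
  then show "wedge \<eta> (dpoly m D) K \<in> Rm m"
    unfolding wedge_dpoly by (auto intro!: Rm_intros mpderiv_Rm D)
  assume ne: "wedge \<eta> (dpoly m D) K \<noteq> 0"
  then have "finite K"
    unfolding wedge_dpoly by (rule contrapos_np) simp
  obtain b where "b \<in> K" "(-1) ^ card {a \<in> K. b < a} * \<eta> (K - {b}) * (if b < m then mpderiv b D else 0) \<noteq> 0"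
    using ne unfolding wedge_dpoly by (rule sum.not_neutral_contains_not_neutral)
  then have b: "b \<in> K" "\<eta> (K - {b}) \<noteq> 0" "b < m"
    by (auto split: if_splits)
  with \<eta> have Kb: "K - {b} \<subseteq> {..<m}" "int (card (K - {b})) = r"
    unfolding is_form_def by blast+
  show "K \<subseteq> {..<m}"
    using Kb(1) b(3) by blast
  show "int (card K) = r + 1"
    using card_Suc_Diff1[OF \<open>finite K\<close> b(1)] Kb(2) by linarith
qed

lemma is_form_wedge_dD:
  assumes "is_form m r \<alpha>" "set Ds \<subseteq> Rm m"
  shows "is_form m (r + int (length Ds)) (wedge_dD m \<alpha> Ds)"
  using assms(2)
proof (induction Ds rule: rev_induct)
  case (snoc D Ds)
  then have "is_form m (r + int (length Ds) + 1) (wedge (wedge_dD m \<alpha> Ds) (dpoly m D))"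
    by (intro is_form_wedge_dpoly) auto
  then show ?case
    by (simp add: wedge_dD_def add_ac)
qed (use assms(1) in \<open>simp add: wedge_dD_def\<close>)

subsection \<open>Components through a point\<close>

text \<open>Elements chosen in each \<open>Is i \<inter> M\<close> are multiplied. With
  \<open>M\<close> the complement of a prime ideal, this says that a prime containing the
  intersection contains some \<open>Is i\<close>.\<close>

lemma ideal_Inter_meets:
  assumes "finite A" and "\<And>i. i \<in> A \<Longrightarrow> is_ideal m (Is i)" "\<And>i. i \<in> A \<Longrightarrow> Is i \<inter> M \<noteq> {}"
    and one: "1 \<in> M" and mult: "\<And>f g. f \<in> Rm m \<Longrightarrow> g \<in> Rm m \<Longrightarrow> f \<in> M \<Longrightarrow> g \<in> M \<Longrightarrow> f * g \<in> M"
  shows "ideal_Inter m A Is \<inter> M \<noteq> {}"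
  using assms(1-3)
proof (induction A)
  case empty
  then show ?case
    using one Rm_one[of m] by (auto simp: ideal_Inter_def simp del: Rm_one)
next
  case (insert i A)
  then obtain f g where f: "f \<in> ideal_Inter m A Is" "f \<in> M" and g: "g \<in> Is i" "g \<in> M"
    by blast
  have idl: "is_ideal m (Is i)" and idl': "is_ideal m (ideal_Inter m A Is)"
    using insert.prems by (auto intro: is_ideal_ideal_Inter)
  have R: "f \<in> Rm m" "g \<in> Rm m"
    using ideal_subset[OF idl g(1)] ideal_subset[OF idl' f(1)] by auto
  have "f * g \<in> Is i" "f * g \<in> ideal_Inter m A Is"
    using R f g by (auto intro: ideal_mult[OF idl] ideal_mult_right[OF idl'])
  then have "f * g \<in> ideal_Inter m (insert i A) Is"
    by (auto simp: ideal_Inter_def)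
  with mult[OF R f(2) g(2)] show ?case
    by blast
qed

text \<open>A primary \<open>Is i\<close> vanishing at \<open>p\<close> contains
  \<open>local_ideal m p I\<close>, since no power of a polynomial nonzero at \<open>p\<close> lies
  in it. The local ideal is prime and contains \<open>I\<close>, hence some \<open>Is c\<close>. Any
  other component through \<open>p\<close> would contain \<open>Is c\<close>, and so the
  intersection of the others, against irredundance.\<close>

lemma unique_component_of_local_prime:
  assumes decomp: "irredundant_primary_decomposition m I n Is"
    and prime: "\<And>f g. f \<in> Rm m \<Longrightarrow> g \<in> Rm m \<Longrightarrow> f \<notin> local_ideal m p I \<Longrightarrow> g \<notin> local_ideal m p I
      \<Longrightarrow> f * g \<notin> local_ideal m p I"
    and a: "a \<in> {1..n}" "\<And>f. f \<in> Is a \<Longrightarrow> meval f p = 0"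
    and b: "b \<in> {1..n}" "\<And>f. f \<in> Is b \<Longrightarrow> meval f p = 0"
  shows "a = b"
proof -
  have I: "I = ideal_Inter m {1..n} Is"
    and primary: "\<And>i. i \<in> {1..n} \<Longrightarrow> is_primary m (Is i)"
    and irred: "\<And>i. i \<in> {1..n} \<Longrightarrow> \<not> ideal_Inter m ({1..n} - {i}) Is \<subseteq> Is i"
    using decomp by (auto simp: irredundant_primary_decomposition_def)
  have I_sub: "I \<subseteq> Is i" if "i \<in> {1..n}" for i
    using that by (auto simp: I ideal_Inter_def)
  have idl: "is_ideal m (Is i)" if "i \<in> {1..n}" for i
    using primary[OF that] by (simp add: is_primary_def)
  have local_sub: "local_ideal m p I \<subseteq> Is i"
    if i: "i \<in> {1..n}" "\<And>f. f \<in> Is i \<Longrightarrow> meval f p = 0" for i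
  proof
    fix f assume "f \<in> local_ideal m p I"
    then obtain s where s: "f \<in> Rm m" "s \<in> Rm m" "meval s p \<noteq> 0" "s * f \<in> Is i"
      using I_sub[OF i(1)] by (auto simp: local_ideal_def)
    then have "f \<in> Is i \<or> (\<exists>k. s ^ k \<in> Is i)"
      using primary[OF i(1)] unfolding is_primary_def by (metis mult.commute)
    moreover have "s ^ k \<notin> Is i" for k
      using i(2)[of "s ^ k"] s(3) by (auto simp: meval_simps)
    ultimately show "f \<in> Is i"
      by blast
  qed
  have "\<exists>c\<in>{1..n}. Is c \<subseteq> local_ideal m p I"
  proof (rule ccontr)
    assume no: "\<not> ?thesis"
    have "1 \<notin> local_ideal m p I"
      using I_sub[OF a(1)] a(2) by (auto simp: local_ideal_def)
    moreover have "Is i \<inter> - local_ideal m p I \<noteq> {}" if "i \<in> {1..n}" for i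
      using no that by blast
    ultimately have "ideal_Inter m {1..n} Is \<inter> - local_ideal m p I \<noteq> {}"
      using prime idl by (intro ideal_Inter_meets) auto
    moreover have "I \<subseteq> local_ideal m p I"
    proof
      fix f assume "f \<in> I"
      then have "f \<in> Rm m" "1 * f \<in> I"
        by (auto simp: I ideal_Inter_def)
      then show "f \<in> local_ideal m p I"
        unfolding local_ideal_def by (auto simp: meval_simps intro!: bexI[of _ 1])
    qed
    ultimately show False
      using I by blast
  qed
  then obtain c where c: "c \<in> {1..n}" "Is c \<subseteq> local_ideal m p I" ..
  have eq_c: "i = c" if i: "i \<in> {1..n}" "\<And>f. f \<in> Is i \<Longrightarrow> meval f p = 0" for i
  proof (rule ccontr)
    assume "i \<noteq> c"
    with c(1) have "ideal_Inter m ({1..n} - {i}) Is \<subseteq> Is c"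
      by (auto simp: ideal_Inter_def)
    also have "\<dots> \<subseteq> Is i"
      using c(2) local_sub[OF i] by blast
    finally show False
      using irred[OF i(1)] by blast
  qed
  show ?thesis
    using eq_c[OF a] eq_c[OF b] by simp
qed

text \<open>A product nonzero at \<open>p\<close> provides dual vectors for the differentials, and
  the generators vanish at \<open>p\<close> because \<open>I \<subseteq> Is a\<close>; so
  \<open>transversal\<close> applies and yields primality.\<close>

lemma unique_component_through_point:
  assumes Ds: "set Ds \<subseteq> Rm m" and I: "I = ideal_gen m (set Ds)"
    and decomp: "irredundant_primary_decomposition m I n Is"
    and ne: "meval (wedge_dD m \<alpha> Ds K) p \<noteq> 0"
    and a: "a \<in> {1..n}" "\<And>f. f \<in> Is a \<Longrightarrow> meval f p = 0"
    and b: "b \<in> {1..n}" "\<And>f. f \<in> Is b \<Longrightarrow> meval f p = 0"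
  shows "a = b"
proof -
  let ?k = "length Ds"
  have "\<exists>V. \<forall>i<length (map (grad m p) Ds). \<forall>l<length (map (grad m p) Ds).
      (\<Sum>a<m. (map (grad m p) Ds ! i) a * V l a) = (if i = l then 1 else 0)"
  proof (rule dual_vectors)
    show "foldl cwedge (\<lambda>A. meval (\<alpha> A) p) (map (grad m p) Ds) K \<noteq> 0"
      using ne by (simp only: meval_wedge_dD not_False_eq_True)
  qed (auto simp: grad_def)
  then obtain V where V: "\<forall>i<?k. \<forall>l<?k. (\<Sum>a<m. grad m p (Ds ! i) a * V l a) = (if i = l then 1 else 0)"
    by auto
  have "I \<subseteq> Is a"
    using decomp a(1) by (auto simp: irredundant_primary_decomposition_def ideal_Inter_def)
  then have zero: "meval D p = 0" if "D \<in> set Ds" for D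
    using that a(2) ideal_gen_superset[of "set Ds" m] I by blast
  interpret transversal m ?k "\<lambda>i. Ds ! i" p V
  proof
    fix i l assume "i < ?k" "l < ?k"
    with V show "(\<Sum>a<m. meval (mpderiv a (Ds ! i)) p * V l a) = (if i = l then 1 else 0)"
      by (simp add: grad_def)
  qed (use Ds zero in auto)
  have "(\<lambda>i. Ds ! i) ` {..<?k} = set Ds"
    by (auto simp: set_conv_nth)
  then have "I = ideal_gen m ((\<lambda>i. Ds ! i) ` {..<?k})"
    using I by simp
  from local_ideal_mult[OF this] show ?thesis
    by (intro unique_component_of_local_prime[OF decomp _ a b]) auto
qed

section \<open>Gluing over the components\<close>

theorem theorem1:
  fixes m n :: nat and Ds :: "mpoly list" and I :: "mpoly set" and Is :: "nat \<Rightarrow> mpoly set"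
  assumes Ds_R: "set Ds \<subseteq> Rm m"
    and I_def: "I = ideal_gen m (set Ds)"
    and decomp: "irredundant_primary_decomposition m I n Is"
    and dim: "\<forall>i\<in>{1..n}. alg_dim m (zero_locus m (Is i)) = int m - int (length Ds)"
    and rad: "\<forall>i\<in>{1..n-1}. is_radical m (ideal_sum (ideal_Inter m {1..i} Is) (Is (Suc i)))"
  shows "\<forall>\<alpha> :: nat \<Rightarrow> mform. (\<forall>i\<in>{1..n}. is_form m (int m - int (length Ds) - 1) (\<alpha> i)) \<longrightarrow>
           (\<exists>\<omega>. is_form m (int m - 1) \<omega> \<and>
                (\<forall>i\<in>{1..n}. form_eq_mod (Is i) \<omega> (wedge_dD m (\<alpha> i) Ds)))"
proof (intro allI impI)
  fix \<alpha> :: "nat \<Rightarrow> mform"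
  assume \<alpha>: "\<forall>i\<in>{1..n}. is_form m (int m - int (length Ds) - 1) (\<alpha> i)"
  let ?w = "\<lambda>i. wedge_dD m (\<alpha> i) Ds"
  have w: "is_form m (int m - 1) (?w i)" if "i \<in> {1..n}" for i
    using is_form_wedge_dD[OF \<alpha>[rule_format, OF that] Ds_R] by simp
  have idl: "is_ideal m (Is i)" if "i \<in> {1..n}" for i
    using decomp that by (simp add: irredundant_primary_decomposition_def is_primary_def)
  have "\<exists>\<omega>. is_form m (int m - 1) \<omega> \<and> (\<forall>j\<in>{1..i}. form_eq_mod (Is j) \<omega> (?w j))"
    if "i \<le> n" for i
    using that
  proof (induction i)
    case 0
    show ?case
      by (rule exI[of _ "\<lambda>_. 0"]) (simp add: is_form_def)
  next
    case (Suc i)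
    then obtain \<omega> where \<omega>: "is_form m (int m - 1) \<omega>"
      and \<omega>_eq: "\<And>j. j \<in> {1..i} \<Longrightarrow> form_eq_mod (Is j) \<omega> (?w j)"
      by auto
    show ?case
    proof (cases "i = 0")
      \<comment> \<open>For the first component no earlier form has to be matched; the radical
        hypothesis starts at index 1.\<close>
      case True
      with Suc.prems w[of 1] ideal_zero[OF idl[of 1]] show ?thesis
        by (intro exI[of _ "?w 1"]) (simp add: form_eq_mod_def)
    next
      case False
      let ?J = "ideal_Inter m {1..i} Is"
      let ?S = "ideal_sum ?J (Is (Suc i))"
      have iS: "Suc i \<in> {1..n}"
        using Suc.prems by simp
      have J: "is_ideal m ?J"
        using Suc.prems by (intro is_ideal_ideal_Inter idl) auto
      note sup = ideal_sum_superset[OF J idl[OF iS]]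
      have S: "ideal_radical m ?S = ?S"
        using rad False Suc.prems by (auto simp: is_radical_def)
      have diff: "\<omega> K - ?w (Suc i) K \<in> ?S" for K
      proof (rule ccontr)
        assume notin: "\<omega> K - ?w (Suc i) K \<notin> ?S"
        have "\<omega> K - ?w (Suc i) K \<in> Rm m"
          using \<omega> w[OF iS] by (auto simp: is_form_def intro: Rm_diff)
        with notin obtain p where p: "\<And>g. g \<in> ?S \<Longrightarrow> meval g p = 0"
          and ne: "meval (\<omega> K - ?w (Suc i) K) p \<noteq> 0"
          using Nullstellensatz[OF is_ideal_ideal_sum[OF J idl[OF iS]]] unfolding S by blast
        \<comment> \<open>Otherwise a product of polynomials nonzero at \<open>p\<close> would lie
          in \<open>?J\<close>, all of which vanishes at \<open>p\<close>.\<close>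
        have "\<exists>j\<in>{1..i}. \<forall>f\<in>Is j. meval f p = 0"
        proof (rule ccontr)
          assume "\<not> ?thesis"
          then have "Is j \<inter> {f. meval f p \<noteq> 0} \<noteq> {}" if "j \<in> {1..i}" for j
            using that by blast
          then have "?J \<inter> {f. meval f p \<noteq> 0} \<noteq> {}"
            using Suc.prems by (intro ideal_Inter_meets idl) (auto simp: meval_simps)
          with p sup(1) show False
            by blast
        qed
        then obtain j where j: "j \<in> {1..i}" "\<And>f. f \<in> Is j \<Longrightarrow> meval f p = 0"
          by blast
        have jn: "j \<in> {1..n}"
          using j(1) Suc.prems by simp
        have "\<omega> K - ?w j K \<in> Is j"
          using \<omega>_eq[OF j(1)] by (simp add: form_eq_mod_def)
        \<comment> \<open>\<open>\<omega> K\<close> and \<open>?w j K\<close> agree at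
          \<open>p\<close>, so if both products vanished there the difference would vanish
          too.\<close>
        from j(2)[OF this] ne have "meval (?w j K) p \<noteq> 0 \<or> meval (?w (Suc i) K) p \<noteq> 0"
          by (auto simp: meval_simps)
        then obtain \<beta> where "meval (wedge_dD m \<beta> Ds K) p \<noteq> 0"
          by blast
        then have "j = Suc i"
          using p sup(2) by (intro unique_component_through_point[OF Ds_R I_def decomp _ jn j(2) iS]) auto
        with j(1) show False
          by simp
      qed
      then have "\<exists>a. a \<in> ?J \<and> \<omega> K - a - ?w (Suc i) K \<in> Is (Suc i)" for K
      proof -
        obtain a b where ab: "\<omega> K - ?w (Suc i) K = a + b" "a \<in> ?J" "b \<in> Is (Suc i)"
          using diff[of K] by (auto simp: ideal_sum_def)
        then have "\<omega> K - a - ?w (Suc i) K = b"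
          by (simp add: algebra_simps)
        with ab show ?thesis by auto
      qed
      then obtain a where a: "\<And>K. a K \<in> ?J" "\<And>K. \<omega> K - a K - ?w (Suc i) K \<in> Is (Suc i)"
        by metis
      \<comment> \<open>\<open>a K\<close> is chosen separately for each \<open>K\<close> and may be
        nonzero on index sets of the wrong size; the cut-off restores a form of rank
        \<open>m - 1\<close>.\<close>
      define ok where "ok K \<longleftrightarrow> K \<subseteq> {..<m} \<and> int (card K) = int m - 1" for K :: "nat set"
      define \<omega>' where "\<omega>' K = (if ok K then \<omega> K - a K else 0)" for K
      have zero: "\<theta> K = 0" if "is_form m (int m - 1) \<theta>" "\<not> ok K" for \<theta> K
        using that by (auto simp: is_form_def ok_def)
      have "is_form m (int m - 1) \<omega>'"
        unfolding is_form_def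
      proof (intro conjI allI impI)
        fix K
        show "\<omega>' K \<in> Rm m"
          using \<omega> ideal_subset[OF J a(1)] by (simp add: \<omega>'_def is_form_def Rm_diff)
      qed (auto simp: \<omega>'_def ok_def split: if_splits)
      moreover have "form_eq_mod (Is j) \<omega>' (?w j)" if j: "j \<in> {1..Suc i}" for j
        unfolding form_eq_mod_def
      proof
        fix K
        have jn: "j \<in> {1..n}"
          using j Suc.prems by simp
        show "\<omega>' K - ?w j K \<in> Is j"
        proof (cases "ok K")
          case False
          then show ?thesis
            using zero[OF w[OF jn]] ideal_zero[OF idl[OF jn]] by (simp add: \<omega>'_def)
        next
          case True
          show ?thesis
          proof (cases "j = Suc i")
            case True
            then show ?thesis
              using a(2)[of K] \<open>ok K\<close> by (simp add: \<omega>'_def)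
          next
            case False
            with j have j': "j \<in> {1..i}"
              by auto
            \<comment> \<open>The correction lies in \<open>?J \<subseteq> Is j\<close>, so the
              components treated before are not disturbed.\<close>
            have "a K \<in> Is j" "\<omega> K - ?w j K \<in> Is j"
              using a(1)[of K] j' \<omega>_eq[OF j'] by (auto simp: ideal_Inter_def form_eq_mod_def)
            from ideal_diff[OF idl[OF jn] this(2,1)] show ?thesis
              using \<open>ok K\<close> by (simp add: \<omega>'_def algebra_simps)
          qed
        qed
      qed
      ultimately show ?thesis
        by blast
    qed
  qed
  then show "\<exists>\<omega>. is_form m (int m - 1) \<omega> \<and> (\<forall>i\<in>{1..n}. form_eq_mod (Is i) \<omega> (?w i))"
    by blast
qed

end
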